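(* Let $K\colon P\to\mathbf{SCpx}$ be a poset tower and let $p_\ell^1\colon R_\ell\to G_\ell$ and $f_\ell^0\colon G_\ell\to G_{\ell-1}$ be the matrices constructed by the algorithm PiRep described in the context. The routine Lift of this algorithm computes morphisms $f_\ell^1\colon R_\ell\to R_{\ell-1}$ and $\vartheta_{\ell+1}\colon G_{\ell+1}\to R_{\ell-1}$ such that $p_{\ell-1}^1\circ f_\ell^1=f_\ell^0\circ p_\ell^1$ and $p_{\ell-1}^1\circ\vartheta_{\ell+1}=f_\ell^0\circ f_{\ell+1}^0$.
   Context: **Poset towers.** $P$ is a finite poset; $x\prec y$ means $x<y$ with no $z$ satisfying $x<z<y$. $\mathbf{SCpx}$ is the category of finite simplicial complexes and simplicial maps. A poset tower is a functor $K\colon P\to\mathbf{SCpx}$; vertices are labels, and the same label may occur at several grades (elements of $P$). $K_\ell(x)$ is the set of $\ell$-simplices of $K(x)$. The simplex generators are $\mathcal S=\{g_\sigma^x=(x,\sigma): x\in P,\ \sigma\in K(x)\setminus\bigcup_{y\prec x}\operatorname{im}K(y\prec x)\}$, and $\mathcal S_\ell$ is the subset with $\dim\sigma=\ell$. The edge events are $\mathcal C=\{c^{x\prec y}_{v\mapsto w}=(x,y,v,w): x\prec y,\ v\in K_0(x),\ w=K(x\prec y)(v)\in K_0(y),\ v\ne w\}$. **Modules.** A $P$-persistence module is a functor from $P$ to finite-dimensional $\mathbb F_2$-vector spaces. $\operatorname{Proj}[x]$ is $\mathbb F_2$ at all $y\ge x$ and $0$ elsewhere, with identity maps between nonzero spaces;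 projective modules are finite direct sums of these. A morphism $\bigoplus_i\operatorname{Proj}[x_i]\to\bigoplus_j\operatorname{Proj}[y_j]$ is the same as a matrix $(\lambda_{ji})$ over $\mathbb F_2$ with $\lambda_{ji}=0$ unless $y_j\le x_i$; composition is matrix multiplication. $G_\ell=\bigoplus_{g_\sigma^x\in\mathcal S_\ell}\operatorname{Proj}[x]$. **The algorithm PiRep (part relevant to $p^1$, $f^0$, $f^1$, $\vartheta$).** It maintains matrices $p^1,f^0,f^1,\vartheta$ over $\mathbb F_2$ for all degrees at once ($p_\ell^1,f_\ell^0,f_\ell^1,\vartheta_\ell$ are the parts whose columns belong to $\ell$-simplices). Rows of $p^1$, rows and columns of $f^0$, and columns of $\vartheta$ are indexed by simplex generators; columns of $p^1$ (relations), rows and columns of $f^1$, and rows of $\vartheta$ are indexed by graded identifiers $\mathsf r^x$, $x$ being the grade at which the relation is added. $R_\ell=\bigoplus\operatorname{Proj}[x]$ over all columns $\mathsf r^x$ of $p_\ell^1$. For each grade $x$ it keeps a set $L^x_{act}$ of pairs $(\sigma,g)$ with $g\in\mathcal S$, a graph $\mathcal G^x_{act}$ whose vertices are simplex generators together with a special vertex $\Omega$ and whose edges correspond to relations, and a spanning forest $\mathcal F^x_{act}$. The grades are processed in the order of a linear extension of $P$; at grade $x$ call in order: *Collapse(x)*: Set $L^x_{act}=\emptyset$. If $x$ is not minimal set $\mathcal G^x_{act}=\bigcup_{y\prec x}\mathcal F^y_{act}$, otherwise let $\mathcal G^x_{act}$ consist of the vertex $\Omega$. For all $y\prec x$ and all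 $(\sigma,g^z_\rho)\in L^y_{act}$: apply to the vertices of $\sigma$ the vertex map of $K(y\prec x)$ (given by $v\mapsto w$ if $c^{y\prec x}_{v\mapsto w}\in\mathcal C$, else $v\mapsto v$). If the result has no repeated vertices, add $(K(y\prec x)(\sigma),g^z_\rho)$ to $L^x_{act}$. Otherwise, if adding an edge between $\Omega$ and $g^z_\rho$ to $\mathcal G^x_{act}$ creates no cycle, add this edge and a new column $\mathsf r^x$ to $p^1$ with single nonzero entry in row $g^z_\rho$. *Generator(x)*: (1) For all $g^x_\sigma\in\mathcal S$ of grade $x$, in increasing order of simplex dimension: add $(\sigma,g^x_\sigma)$ to $L^x_{act}$, add the vertex $g^x_\sigma$ to $\mathcal G^x_{act}$, then find $(\tau_1,g_1),\dots,(\tau_k,g_k)\in L^x_{act}$ with $\sum_i\tau_i=\partial\sigma$ (one pair for each facet $\tau_i$ of $\sigma$) and add a column $g^x_\sigma$ to $f^0$ with entries $1$ exactly in rows $g_1,\dots,g_k$. (2) For every two pairs $(\sigma,g),(\sigma,g')\in L^x_{act}$ with the same simplex and $g\ne g'$: if adding an edge between $g$ and $g'$ to $\mathcal G^x_{act}$ creates no cycle, add it and add a new column $\mathsf r^x$ to $p^1$ with entries $1$ exactly in rows $g,g'$; then (in either case) delete $(\sigma,g')$ from $L^x_{act}$. (3) Let $\mathcal F^x_{act}$ be a spanning forest of $\mathcal G^x_{act}$. *Lift(x)*: (1) For each column $\mathsf r^x$ of $p^1$ added at grade $x$: let $b$ be the column of $f^0p^1$ indexed by $\mathsf r^x$, restricted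 to the vertices of $\mathcal F^x_{act}$ other than $\Omega$, and extended by the entry $b[\Omega]=$ sum over $\mathbb F_2$ of all entries of that column. For each connected component $C$ of $\mathcal F^x_{act}$, with vertex set $V(C)$ and edge set $E(C)$, set $f^1[E(C),\mathsf r^x]$ to be the output of TreeSolve$(C,b[V(C)])$; all other entries of the column are $0$. (2) For each generator $g^x_\sigma$ of grade $x$: do the same with the column of $f^0f^0$ indexed by $g^x_\sigma$ in place of that of $f^0p^1$, setting $\vartheta[E(C),g^x_\sigma]$ to be the output of TreeSolve; all other entries are $0$. *TreeSolve$(C,b)$*: order the vertices $v_1,\dots,v_m$ of the tree $C$ such that $v_i$ has degree at most one in $C\setminus\{v_1,\dots,v_{i-1}\}$; for $i=1,\dots,m-1$ let $e_i$ be the unique edge of $C\setminus\{v_1,\dots,v_{i-1}\}$ incident to $v_i$ and set $x(e_i)=b(v_i)+\sum x(e')\in\mathbb F_2$, the sum over edges $e'\ne e_i$ of $C$ incident to $v_i$ (whose values are already set). Output $x$. *)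

theory Defs
  imports "HOL-Library.Z2"
begin

section \<open>Poset towers\<close>

definition fin_simplicial_complex :: "'v set set \<Rightarrow> bool" where
  "fin_simplicial_complex X \<longleftrightarrow> finite X \<and> (\<forall>\<sigma>\<in>X. finite \<sigma> \<and> \<sigma> \<noteq> {}) \<and>
     (\<forall>\<sigma>\<in>X. \<forall>\<tau>. \<tau> \<subseteq> \<sigma> \<and> \<tau> \<noteq> {} \<longrightarrow> \<tau> \<in> X)"

text \<open>Dimensions are integers, so that degree \<open>- 1\<close> makes sense.\<close>

definition sdim :: "'v set \<Rightarrow> int" where
  "sdim \<sigma> = int (card \<sigma>) - 1"

text \<open>The empty set is not a simplex: a vertex has no facets.\<close>

definition facets :: "'v set \<Rightarrow> 'v set set" where
  "facets \<sigma> = {\<tau>. \<tau> \<subseteq> \<sigma> \<and> \<tau> \<noteq> {} \<and> sdim \<tau> = sdim \<sigma> - 1}"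

text \<open>A functor into simplicial complexes is given by its complexes and by the vertex maps of its
  simplicial maps; values of \<open>vmap\<close> outside of the vertex sets are irrelevant.\<close>

record ('p, 'v) tower =
  cpx :: "'p \<Rightarrow> 'v set set"
  vmap :: "'p \<Rightarrow> 'p \<Rightarrow> 'v \<Rightarrow> 'v"

definition poset_tower :: "'p::order set \<Rightarrow> ('p, 'v) tower \<Rightarrow> bool" where
  "poset_tower P K \<longleftrightarrow>
     (\<forall>x\<in>P. fin_simplicial_complex (cpx K x)) \<and>
     (\<forall>x\<in>P. \<forall>y\<in>P. x \<le> y \<longrightarrow> (\<forall>\<sigma>\<in>cpx K x. vmap K x y ` \<sigma> \<in> cpx K y)) \<and>
     (\<forall>x\<in>P. \<forall>v. {v} \<in> cpx K x \<longrightarrow> vmap K x x v = v) \<and>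
     (\<forall>x\<in>P. \<forall>y\<in>P. \<forall>z\<in>P. x \<le> y \<and> y \<le> z \<longrightarrow>
        (\<forall>v. {v} \<in> cpx K x \<longrightarrow> vmap K x z v = vmap K y z (vmap K x y v)))"

definition covers :: "'p::order set \<Rightarrow> 'p \<Rightarrow> 'p \<Rightarrow> bool" where
  "covers P x y \<longleftrightarrow> x \<in> P \<and> y \<in> P \<and> x < y \<and> \<not> (\<exists>z\<in>P. x < z \<and> z < y)"

definition linear_extension :: "'p::order set \<Rightarrow> 'p list \<Rightarrow> bool" where
  "linear_extension P xs \<longleftrightarrow> distinct xs \<and> set xs = P \<and> sorted_wrt (\<lambda>x y. \<not> y < x) xs"

type_synonym ('p, 'v) gen = "'p \<times> 'v set"

definition generators :: "'p::order set \<Rightarrow> ('p, 'v) tower \<Rightarrow> ('p, 'v) gen set" where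
  "generators P K =
     {(x, \<sigma>). x \<in> P \<and> \<sigma> \<in> cpx K x \<and> \<sigma> \<notin> (\<Union>y\<in>{y. covers P y x}. (\<lambda>\<tau>. vmap K y x ` \<tau>) ` cpx K y)}"

definition generators_of_dim :: "'p::order set \<Rightarrow> ('p, 'v) tower \<Rightarrow> int \<Rightarrow> ('p, 'v) gen set" where
  "generators_of_dim P K l = {g \<in> generators P K. sdim (snd g) = l}"

definition edge_events :: "'p::order set \<Rightarrow> ('p, 'v) tower \<Rightarrow> ('p \<times> 'p \<times> 'v \<times> 'v) set" where
  "edge_events P K =
     {(x, y, v, w). covers P x y \<and> {v} \<in> cpx K x \<and> {w} \<in> cpx K y \<and> w = vmap K x y v \<and> v \<noteq> w}"

definition event_map :: "'p::order set \<Rightarrow> ('p, 'v) tower \<Rightarrow> 'p \<Rightarrow> 'p \<Rightarrow> 'v \<Rightarrow> 'v" where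
  "event_map P K y x v =
     (if \<exists>w. (y, x, v, w) \<in> edge_events P K then THE w. (y, x, v, w) \<in> edge_events P K else v)"


section \<open>Matrices and morphisms of projective modules\<close>

text \<open>A matrix maps a row index and a column index to an entry.\<close>

type_synonym ('i, 'j) mat = "'i \<Rightarrow> 'j \<Rightarrow> bit"

definition set_column :: "('i, 'j) mat \<Rightarrow> 'j \<Rightarrow> ('i \<Rightarrow> bit) \<Rightarrow> ('i, 'j) mat" where
  "set_column M j c = (\<lambda>i j'. if j' = j then c i else M i j')"

definition columns :: "'j set \<Rightarrow> ('i, 'j) mat \<Rightarrow> ('i, 'j) mat" where
  "columns J M = (\<lambda>i j. if j \<in> J then M i j else 0)"

definition mat_mult :: "'j set \<Rightarrow> ('i, 'j) mat \<Rightarrow> ('j, 'k) mat \<Rightarrow> ('i, 'k) mat" where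
  "mat_mult J M N = (\<lambda>i k. \<Sum>j\<in>J. M i j * N j k)"

text \<open>Indices carry their grade in the first component. \<open>proj_hom A B M\<close> says that \<open>M\<close> is the matrix
  of a morphism from the direct sum of \<open>Proj[fst a]\<close> over \<open>a \<in> A\<close> to the direct sum of
  \<open>Proj[fst b]\<close> over \<open>b \<in> B\<close>; in particular all its nonzero entries lie in rows from \<open>B\<close> and
  columns from \<open>A\<close>.\<close>

definition proj_hom :: "('p::order \<times> 'a) set \<Rightarrow> ('p \<times> 'b) set \<Rightarrow> ('p \<times> 'b, 'p \<times> 'a) mat \<Rightarrow> bool" where
  "proj_hom A B M \<longleftrightarrow> finite A \<and> finite B \<and>
     (\<forall>b a. M b a \<noteq> 0 \<longrightarrow> b \<in> B \<and> a \<in> A \<and> fst b \<le> fst a)"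


section \<open>Multigraphs\<close>

text \<open>An edge is a label together with the set of its endpoints, so parallel edges are possible.\<close>

type_synonym ('n, 'e) edge = "'e \<times> 'n set"

record ('n, 'e) mgraph =
  verts :: "'n set"
  edges :: "('n, 'e) edge set"

definition add_edge :: "('n, 'e) edge \<Rightarrow> ('n, 'e) mgraph \<Rightarrow> ('n, 'e) mgraph" where
  "add_edge e G = G\<lparr>edges := insert e (edges G)\<rparr>"

definition add_vertex :: "'n \<Rightarrow> ('n, 'e) mgraph \<Rightarrow> ('n, 'e) mgraph" where
  "add_vertex v G = G\<lparr>verts := insert v (verts G)\<rparr>"

definition remove_vertex :: "'n \<Rightarrow> ('n, 'e) mgraph \<Rightarrow> ('n, 'e) mgraph" where
  "remove_vertex v G = \<lparr>verts = verts G - {v}, edges = {e \<in> edges G. v \<notin> snd e}\<rparr>"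

definition incident :: "('n, 'e) mgraph \<Rightarrow> 'n \<Rightarrow> ('n, 'e) edge set" where
  "incident G v = {e \<in> edges G. v \<in> snd e}"

text \<open>The edge \<open>es ! i\<close> joins \<open>vs ! i\<close> to the cyclically next vertex. Two parallel edges form a
  cycle of length two.\<close>

definition is_cycle :: "('n, 'e) mgraph \<Rightarrow> 'n list \<Rightarrow> ('n, 'e) edge list \<Rightarrow> bool" where
  "is_cycle G vs es \<longleftrightarrow> vs \<noteq> [] \<and> length es = length vs \<and> distinct vs \<and> distinct es \<and>
     (\<forall>i<length vs. es ! i \<in> edges G \<and> snd (es ! i) = {vs ! i, vs ! (Suc i mod length vs)})"

text \<open>The graph may already contain cycles (it starts as a union of forests); what
  counts is whether the added edge lies on one.\<close>

definition creates_cycle :: "('n, 'e) mgraph \<Rightarrow> ('n, 'e) edge \<Rightarrow> bool" where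
  "creates_cycle G e \<longleftrightarrow> (\<exists>vs es. is_cycle (add_edge e G) vs es \<and> e \<in> set es)"

definition connected_in :: "('n, 'e) mgraph \<Rightarrow> ('n \<times> 'n) set" where
  "connected_in G = {(u, v). \<exists>e\<in>edges G. snd e = {u, v}}\<^sup>*"

definition spanning_forest :: "('n, 'e) mgraph \<Rightarrow> ('n, 'e) mgraph \<Rightarrow> bool" where
  "spanning_forest G F \<longleftrightarrow> verts F = verts G \<and> edges F \<subseteq> edges G \<and>
     (\<nexists>vs es. is_cycle F vs es) \<and> connected_in F = connected_in G"

definition component :: "('n, 'e) mgraph \<Rightarrow> 'n \<Rightarrow> ('n, 'e) mgraph" where
  "component G v = (let V = {w. (v, w) \<in> connected_in G}
     in \<lparr>verts = V, edges = {e \<in> edges G. snd e \<subseteq> V}\<rparr>)"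

definition components :: "('n, 'e) mgraph \<Rightarrow> ('n, 'e) mgraph set" where
  "components G = component G ` verts G"


section \<open>TreeSolve\<close>

fun leaf_order :: "('n, 'e) mgraph \<Rightarrow> 'n list \<Rightarrow> bool" where
  "leaf_order D [] \<longleftrightarrow> verts D = {}"
| "leaf_order D (v # vs) \<longleftrightarrow>
     v \<in> verts D \<and> card (incident D v) \<le> 1 \<and> leaf_order (remove_vertex v D) vs"

text \<open>\<open>C\<close> is the whole tree, \<open>D\<close> is what remains of it after removing the vertices treated so far.
  No edge is assigned at the last vertex.\<close>

fun tree_solve_loop ::
  "('n, 'e) mgraph \<Rightarrow> ('n \<Rightarrow> bit) \<Rightarrow> ('n, 'e) mgraph \<Rightarrow> 'n list \<Rightarrow>
   (('n, 'e) edge \<Rightarrow> bit) \<Rightarrow> ('n, 'e) edge \<Rightarrow> bit" where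
  "tree_solve_loop C b D [] x = x"
| "tree_solve_loop C b D [v] x = x"
| "tree_solve_loop C b D (v # w # vs) x =
     (let e = (THE e. e \<in> incident D v)
      in tree_solve_loop C b (remove_vertex v D) (w # vs)
           (x(e := b v + (\<Sum>e'\<in>incident C v - {e}. x e'))))"

text \<open>\<open>x\<close> is an output of the routine, for some choice of the vertex order.\<close>

definition tree_solve ::
  "('n, 'e) mgraph \<Rightarrow> ('n \<Rightarrow> bit) \<Rightarrow> (('n, 'e) edge \<Rightarrow> bit) \<Rightarrow> bool" where
  "tree_solve C b x \<longleftrightarrow> (\<exists>vs. leaf_order C vs \<and> x = tree_solve_loop C b C vs (\<lambda>_. 0))"


section \<open>The algorithm\<close>

text \<open>Routines are relations between the state before and a possible state afterwards, since the
  algorithm leaves many choices open: iteration orders, representatives,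
  spanning forests, names of new columns.\<close>

datatype ('p, 'v) node = Omega | Gen "('p, 'v) gen"

text \<open>A relation identifier consists of its grade and a number.\<close>

type_synonym 'p rid = "'p \<times> nat"

text \<open>\<open>rels\<close> is the set of the columns that have been added to \<open>p1\<close>. Columns that have not been
  added yet are zero.\<close>

record ('p, 'v) state =
  act :: "'p \<Rightarrow> ('v set \<times> ('p, 'v) gen) set"
  graph :: "'p \<Rightarrow> (('p, 'v) node, 'p rid) mgraph"
  forest :: "'p \<Rightarrow> (('p, 'v) node, 'p rid) mgraph"
  rels :: "'p rid set"
  p1 :: "(('p, 'v) gen, 'p rid) mat"
  f0 :: "(('p, 'v) gen, ('p, 'v) gen) mat"
  f1 :: "('p rid, 'p rid) mat"
  theta :: "('p rid, ('p, 'v) gen) mat"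

definition initial_state :: "('p, 'v) state" where
  "initial_state =
     \<lparr>act = (\<lambda>_. {}), graph = (\<lambda>_. \<lparr>verts = {}, edges = {}\<rparr>),
      forest = (\<lambda>_. \<lparr>verts = {}, edges = {}\<rparr>), rels = {},
      p1 = (\<lambda>_ _. 0), f0 = (\<lambda>_ _. 0), f1 = (\<lambda>_ _. 0), theta = (\<lambda>_ _. 0)\<rparr>"

fun foreach_list :: "('a \<Rightarrow> 's \<Rightarrow> 's \<Rightarrow> bool) \<Rightarrow> 'a list \<Rightarrow> 's \<Rightarrow> 's \<Rightarrow> bool" where
  "foreach_list body [] s s' \<longleftrightarrow> s' = s"
| "foreach_list body (a # as) s s' \<longleftrightarrow> (\<exists>t. body a s t \<and> foreach_list body as t s')"

definition foreach :: "'a set \<Rightarrow> ('a \<Rightarrow> 's \<Rightarrow> 's \<Rightarrow> bool) \<Rightarrow> 's \<Rightarrow> 's \<Rightarrow> bool" where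
  "foreach A body s s' \<longleftrightarrow> (\<exists>as. distinct as \<and> set as = A \<and> foreach_list body as s s')"

text \<open>Unless this creates a cycle, add an edge between \<open>u\<close> and \<open>v\<close> at grade \<open>x\<close>, labelled by a fresh
  identifier, and the corresponding column of \<open>p1\<close>, whose support consists of the generators among
  \<open>u\<close> and \<open>v\<close>.\<close>

definition try_relation ::
  "'p \<Rightarrow> ('p, 'v) node \<Rightarrow> ('p, 'v) node \<Rightarrow> ('p, 'v) state \<Rightarrow> ('p, 'v) state \<Rightarrow> bool" where
  "try_relation x u v s s' \<longleftrightarrow> (\<exists>r. fst r = x \<and> r \<notin> rels s \<and>
     s' = (if creates_cycle (graph s x) (r, {u, v}) then s
           else s\<lparr>graph := (graph s)(x := add_edge (r, {u, v}) (graph s x)),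
                  rels := insert r (rels s),
                  p1 := set_column (p1 s) r (\<lambda>g. of_bool (Gen g \<in> {u, v}))\<rparr>))"

definition collapse_init :: "'p::order set \<Rightarrow> 'p \<Rightarrow> ('p, 'v) state \<Rightarrow> ('p, 'v) state" where
  "collapse_init P x s = s\<lparr>act := (act s)(x := {}),
     graph := (graph s)(x :=
       if \<exists>y\<in>P. y < x
       then \<lparr>verts = (\<Union>y\<in>{y. covers P y x}. verts (forest s y)),
             edges = (\<Union>y\<in>{y. covers P y x}. edges (forest s y))\<rparr>
       else \<lparr>verts = {Omega}, edges = {}\<rparr>)\<rparr>"

definition collapse_step ::
  "'p::order set \<Rightarrow> ('p, 'v) tower \<Rightarrow> 'p \<Rightarrow> 'p \<times> 'v set \<times> ('p, 'v) gen \<Rightarrow>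
   ('p, 'v) state \<Rightarrow> ('p, 'v) state \<Rightarrow> bool" where
  "collapse_step P K x = (\<lambda>(y, \<sigma>, g) s s'.
     if inj_on (event_map P K y x) \<sigma>
     then s' = s\<lparr>act := (act s)(x := insert (vmap K y x ` \<sigma>, g) (act s x))\<rparr>
     else try_relation x Omega (Gen g) s s')"

definition collapse ::
  "'p::order set \<Rightarrow> ('p, 'v) tower \<Rightarrow> 'p \<Rightarrow> ('p, 'v) state \<Rightarrow> ('p, 'v) state \<Rightarrow> bool" where
  "collapse P K x s s' \<longleftrightarrow>
     foreach {(y, \<sigma>, g). covers P y x \<and> (\<sigma>, g) \<in> act s y} (collapse_step P K x)
       (collapse_init P x s) s'"

text \<open>\<open>\<phi>\<close> chooses one pair \<open>(\<tau>, \<phi> \<tau>)\<close> for each facet \<open>\<tau>\<close>.\<close>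

definition add_generator :: "('p, 'v) gen \<Rightarrow> ('p, 'v) state \<Rightarrow> ('p, 'v) state \<Rightarrow> bool" where
  "add_generator = (\<lambda>(x, \<sigma>) s s'.
     let t = s\<lparr>act := (act s)(x := insert (\<sigma>, (x, \<sigma>)) (act s x)),
               graph := (graph s)(x := add_vertex (Gen (x, \<sigma>)) (graph s x))\<rparr>
     in \<exists>\<phi>. (\<forall>\<tau>\<in>facets \<sigma>. (\<tau>, \<phi> \<tau>) \<in> act t x) \<and>
          s' = t\<lparr>f0 := set_column (f0 t) (x, \<sigma>) (\<lambda>g. of_bool (g \<in> \<phi> ` facets \<sigma>))\<rparr>)"

definition add_generators ::
  "'p::order set \<Rightarrow> ('p, 'v) tower \<Rightarrow> 'p \<Rightarrow> ('p, 'v) state \<Rightarrow> ('p, 'v) state \<Rightarrow> bool" where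
  "add_generators P K x s s' \<longleftrightarrow>
     (\<exists>gs. distinct gs \<and> set gs = {g \<in> generators P K. fst g = x} \<and>
        sorted (map (\<lambda>g. sdim (snd g)) gs) \<and> foreach_list add_generator gs s s')"

definition merge_step :: "'p \<Rightarrow> ('p, 'v) state \<Rightarrow> ('p, 'v) state \<Rightarrow> bool" where
  "merge_step x s s' \<longleftrightarrow> (\<exists>\<sigma> g g' t. (\<sigma>, g) \<in> act s x \<and> (\<sigma>, g') \<in> act s x \<and> g \<noteq> g' \<and>
     try_relation x (Gen g) (Gen g') s t \<and>
     s' = t\<lparr>act := (act t)(x := act t x - {(\<sigma>, g')})\<rparr>)"

text \<open>The loop runs until no two pairs with the same simplex are left.\<close>

definition merge :: "'p \<Rightarrow> ('p, 'v) state \<Rightarrow> ('p, 'v) state \<Rightarrow> bool" where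
  "merge x s s' \<longleftrightarrow> (merge_step x)\<^sup>*\<^sup>* s s' \<and>
     (\<forall>\<sigma> g g'. (\<sigma>, g) \<in> act s' x \<and> (\<sigma>, g') \<in> act s' x \<longrightarrow> g = g')"

definition choose_forest :: "'p \<Rightarrow> ('p, 'v) state \<Rightarrow> ('p, 'v) state \<Rightarrow> bool" where
  "choose_forest x s s' \<longleftrightarrow>
     (\<exists>F. spanning_forest (graph s x) F \<and> s' = s\<lparr>forest := (forest s)(x := F)\<rparr>)"

definition generator ::
  "'p::order set \<Rightarrow> ('p, 'v) tower \<Rightarrow> 'p \<Rightarrow> ('p, 'v) state \<Rightarrow> ('p, 'v) state \<Rightarrow> bool" where
  "generator P K x = add_generators P K x OO merge x OO choose_forest x"

text \<open>\<open>d\<close> is a possible column computed by solving, on each tree of the forest \<open>F\<close>, for the column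
  \<open>c\<close> extended to \<open>Omega\<close>.\<close>

definition lift_column ::
  "'p::order set \<Rightarrow> ('p, 'v) tower \<Rightarrow> (('p, 'v) node, 'p rid) mgraph \<Rightarrow>
   (('p, 'v) gen \<Rightarrow> bit) \<Rightarrow> ('p rid \<Rightarrow> bit) \<Rightarrow> bool" where
  "lift_column P K F c d \<longleftrightarrow>
     (let b = (\<lambda>n. case n of Omega \<Rightarrow> \<Sum>g\<in>generators P K. c g | Gen g \<Rightarrow> c g)
      in (\<forall>C\<in>components F. \<exists>x. tree_solve C b x \<and> (\<forall>e\<in>edges C. d (fst e) = x e)) \<and>
         (\<forall>r. r \<notin> fst ` edges F \<longrightarrow> d r = 0))"

definition lift_routine ::
  "'p::order set \<Rightarrow> ('p, 'v) tower \<Rightarrow> 'p \<Rightarrow> ('p, 'v) state \<Rightarrow> ('p, 'v) state \<Rightarrow> bool" where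
  "lift_routine P K x s s' \<longleftrightarrow> (\<exists>M T.
     (\<forall>r. if r \<in> rels s \<and> fst r = x
        then lift_column P K (forest s x)
               (\<lambda>g. mat_mult (generators P K) (f0 s) (p1 s) g r) (\<lambda>r'. M r' r)
        else (\<forall>r'. M r' r = f1 s r' r)) \<and>
     (\<forall>g. if g \<in> generators P K \<and> fst g = x
        then lift_column P K (forest s x)
               (\<lambda>h. mat_mult (generators P K) (f0 s) (f0 s) h g) (\<lambda>r'. T r' g)
        else (\<forall>r'. T r' g = theta s r' g)) \<and>
     s' = s\<lparr>f1 := M, theta := T\<rparr>)"

text \<open>\<open>pirep P K xs s\<close>: processing the grades in the order \<open>xs\<close> can end in the state \<open>s\<close>.\<close>

definition pirep ::
  "'p::order set \<Rightarrow> ('p, 'v) tower \<Rightarrow> 'p list \<Rightarrow> ('p, 'v) state \<Rightarrow> bool" where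
  "pirep P K xs s \<longleftrightarrow>
     foreach_list (\<lambda>x. collapse P K x OO generator P K x OO lift_routine P K x) xs initial_state s"

text \<open>The degree of a relation is the dimension of the generators in the support of its column.\<close>

definition relations_of_dim :: "('p, 'v) state \<Rightarrow> int \<Rightarrow> 'p rid set" where
  "relations_of_dim s l = {r \<in> rels s. \<exists>g. p1 s g r \<noteq> 0 \<and> sdim (snd g) = l}"

end

theory Submission
  imports Defs
begin

text \<open>
  Fix a grade \<open>x\<close> and a function on the nodes of the forest at \<open>x\<close> that is constant on components and
  vanishes at \<open>Omega\<close>. A generator that is still nondegenerate at \<open>x\<close> is connected to the generator
  representing its image in \<open>K(x)\<close>, a degenerate one to \<open>Omega\<close>, so the function factors through
  the simplices of \<open>K(x)\<close>. Pairing it with a column of \<open>f\<^sup>0p\<^sup>1\<close> or \<open>f\<^sup>0f\<^sup>0\<close> therefore gives \<open>0\<close>,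
  because simplicial maps are chain maps and the boundary squares to zero. Hence the right-hand side
  passed to TreeSolve sums to zero on each tree, which is exactly the solvability condition. The
  grading is respected because the solution on a tree is unique, and trees of generators of
  different dimensions meet only at \<open>Omega\<close>.
\<close>

text \<open>On the edges of a forest, \<open>p1\<close> is the incidence matrix of the forest with
  the row of \<open>Omega\<close> removed, and the entry that Lift puts at \<open>Omega\<close> is
  the only one that the missing row can have. This explains the two conditions on a test function:
  constancy on components puts it in the left kernel of the full incidence matrix, and vanishing at
  \<open>Omega\<close> confines the pairing to the rows that \<open>p1\<close> has. A second
  obstacle is that the columns are computed while the matrices are still growing, whereas the
  identities concern the final matrices. Every grade is therefore shown to leave the results of the
  earlier ones intact. This works because the columns of a grade are supported on generators of that
  grade or below, and the processed grades form a down-set. Existence of a run is proved together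
  with correctness, since each routine can proceed only because of the invariants left by the
  preceding ones.\<close>

text \<open>These rules turn sums and products of bits into bit operations.\<close>

declare add_bit_eq_xor [simp del] mult_bit_eq_and [simp del]

lemma add_self_bit [simp]: "(a::bit) + a = 0"
  by (cases a) (simp_all add: one_add_one)

lemma add_self_bit_left [simp]: "(a::bit) + (a + b) = b"
  by (simp flip: add.assoc)

section \<open>Multigraphs\<close>

text \<open>Loops are excluded because a loop would enter the sum over all vertices once instead of
  twice, so that \<open>sum_vertices_incident\<close> would fail.\<close>

definition wf_mgraph :: "('n, 'e) mgraph \<Rightarrow> bool" where
  "wf_mgraph G \<longleftrightarrow> finite (verts G) \<and> finite (edges G) \<and>
     (\<forall>e\<in>edges G. card (snd e) = 2 \<and> snd e \<subseteq> verts G)"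

lemma connected_in_refl [simp]: "(u, u) \<in> connected_in G"
  by (simp add: connected_in_def)

lemma connected_in_trans: "(u, v) \<in> connected_in G \<Longrightarrow> (v, w) \<in> connected_in G \<Longrightarrow> (u, w) \<in> connected_in G"
  unfolding connected_in_def by (rule rtrancl_trans)

lemma connected_in_sym: "(u, v) \<in> connected_in G \<Longrightarrow> (v, u) \<in> connected_in G"
  unfolding connected_in_def by (rule symD[OF sym_rtrancl]) (auto simp: sym_def insert_commute)

lemma connected_in_edge: "e \<in> edges G \<Longrightarrow> snd e = {u, v} \<Longrightarrow> (u, v) \<in> connected_in G"
  unfolding connected_in_def by (rule r_into_rtrancl) auto

lemma connected_in_mono:
  assumes "edges G \<subseteq> edges H"
  shows "connected_in G \<subseteq> connected_in H"
  unfolding connected_in_def using assms by (intro rtrancl_mono) auto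

lemma connected_in_induct [consumes 1, case_names refl step]:
  assumes "(u, v) \<in> connected_in G" and "Q u"
    and "\<And>v w e. (u, v) \<in> connected_in G \<Longrightarrow> e \<in> edges G \<Longrightarrow> snd e = {v, w} \<Longrightarrow> Q v \<Longrightarrow> Q w"
  shows "Q v"
  using assms(1) unfolding connected_in_def
proof (induction rule: rtrancl_induct)
  case base
  show ?case by (fact assms(2))
next
  case (step y z)
  then show ?case using assms(3) by (auto simp: connected_in_def)
qed

lemma connected_in_subset_if:
  assumes "\<And>e u v. e \<in> edges G \<Longrightarrow> snd e = {u, v} \<Longrightarrow> (u, v) \<in> connected_in H"
  shows "connected_in G \<subseteq> connected_in H"
proof safe
  fix u v
  assume "(u, v) \<in> connected_in G"
  then show "(u, v) \<in> connected_in H"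
    by (induction rule: connected_in_induct) (auto intro: assms connected_in_trans)
qed

lemma connected_in_verts:
  assumes "(u, v) \<in> connected_in G" "wf_mgraph G" "u \<in> verts G"
  shows "v \<in> verts G"
  using assms(1) by (induction rule: connected_in_induct) (use assms in \<open>auto simp: wf_mgraph_def\<close>)

text \<open>Going once around the cycle avoids the removed edge.\<close>

lemma is_cycle_connected_without:
  assumes cyc: "is_cycle G vs es" and e: "e \<in> set es" "snd e = {u, v}"
  shows "(u, v) \<in> connected_in (G\<lparr>edges := edges G - {e}\<rparr>)"
proof -
  let ?H = "G\<lparr>edges := edges G - {e}\<rparr>" and ?n = "length vs"
  have len: "length es = ?n" and "distinct es" and n0: "?n > 0"
    and E: "\<And>i. i < ?n \<Longrightarrow> es ! i \<in> edges G \<and> snd (es ! i) = {vs ! i, vs ! (Suc i mod ?n)}"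
    using cyc by (auto simp: is_cycle_def)
  obtain k where k: "k < ?n" "es ! k = e"
    using e len by (metis in_set_conv_nth)
  have *: "(vs ! (Suc k mod ?n), vs ! ((Suc k + j) mod ?n)) \<in> connected_in ?H" if "j < ?n" for j
    using that
  proof (induction j)
    case 0
    then show ?case by simp
  next
    case (Suc j)
    define i where "i = (Suc k + j) mod ?n"
    have "i < ?n" using n0 by (simp add: i_def)
    have "i \<noteq> k"
    proof
      assume "i = k"
      then have "(Suc k + j) mod ?n = k mod ?n" using k by (simp add: i_def)
      then have "?n dvd (Suc k + j) - k" by (simp add: mod_eq_dvd_iff_nat)
      then have "?n dvd Suc j" by simp
      then show False using Suc.prems by (auto dest: dvd_imp_le)
    qed
    then have "es ! i \<noteq> e"
      using k \<open>i < ?n\<close> \<open>distinct es\<close> len by (metis nth_eq_iff_index_eq)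
    then have "es ! i \<in> edges ?H" using E \<open>i < ?n\<close> by simp
    moreover have "snd (es ! i) = {vs ! i, vs ! ((Suc k + Suc j) mod ?n)}"
      using E[OF \<open>i < ?n\<close>] by (simp add: i_def mod_Suc_eq)
    ultimately have "(vs ! i, vs ! ((Suc k + Suc j) mod ?n)) \<in> connected_in ?H"
      by (rule connected_in_edge)
    with Suc show ?case unfolding i_def by (meson Suc_lessD connected_in_trans)
  qed
  \<comment> \<open>After \<open>?n - 1\<close> steps from the far end of the removed edge the walk
    is back at its near end.\<close>
  have "Suc k + (?n - 1) = k + ?n" using n0 by simp
  then have "(Suc k + (?n - 1)) mod ?n = k" using k by simp
  then have c: "(vs ! (Suc k mod ?n), vs ! k) \<in> connected_in ?H"
    using *[of "?n - 1"] n0 by simp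
  have "{u, v} = {vs ! k, vs ! (Suc k mod ?n)}" using E[OF k(1)] k e by simp
  then show ?thesis using c connected_in_sym[OF c] by (auto simp: doubleton_eq_iff)
qed

text \<open>Refusing an edge is harmless: its ends are joined already, so after
  \<open>try_relation\<close> they are connected in either case.\<close>

lemma creates_cycle_connected:
  assumes "creates_cycle G (r, {u, v})"
  shows "(u, v) \<in> connected_in G"
proof -
  obtain vs es where "is_cycle (add_edge (r, {u, v}) G) vs es" "(r, {u, v}) \<in> set es"
    using assms by (auto simp: creates_cycle_def)
  from is_cycle_connected_without[OF this, of u v]
  show ?thesis
    by (auto simp: add_edge_def elim!: subsetD[OF connected_in_mono, rotated])
qed

section \<open>Acyclic multigraphs: spanning forests, leaves, and vertex sums modulo 2\<close>

definition acyclic_mgraph :: "('n, 'e) mgraph \<Rightarrow> bool" where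
  "acyclic_mgraph G \<longleftrightarrow> (\<nexists>vs es. is_cycle G vs es)"

lemma is_cycle_mono: "is_cycle G vs es \<Longrightarrow> edges G \<subseteq> edges H \<Longrightarrow> is_cycle H vs es"
  by (auto simp: is_cycle_def)

lemma acyclic_mgraph_mono: "acyclic_mgraph H \<Longrightarrow> edges G \<subseteq> edges H \<Longrightarrow> acyclic_mgraph G"
  by (auto simp: acyclic_mgraph_def dest: is_cycle_mono)

text \<open>As long as there is a cycle, delete one of its edges;
  \<open>is_cycle_connected_without\<close> preserves connectivity. The graph of a grade may contain
  cycles because it starts as a union of forests.\<close>

lemma spanning_forest_exists:
  fixes G :: "('n, 'e) mgraph"
  assumes "finite (edges G)"
  shows "\<exists>F. spanning_forest G F"
proof -
  have "\<exists>F. verts F = verts H \<and> edges F \<subseteq> edges H \<and> acyclic_mgraph F \<and>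
      connected_in F = connected_in H" if "finite (edges H)" for H :: "('n, 'e) mgraph"
    using that
  proof (induction "card (edges H)" arbitrary: H rule: less_induct)
    case less
    show ?case
    proof (cases "acyclic_mgraph H")
      case False
      then obtain vs es where c: "is_cycle H vs es" by (auto simp: acyclic_mgraph_def)
      define e where "e = es ! 0"
      have e: "e \<in> set es" "e \<in> edges H" using c by (auto simp: is_cycle_def e_def)
      let ?H = "H\<lparr>edges := edges H - {e}\<rparr>"
      have "connected_in H \<subseteq> connected_in ?H"
      proof (rule connected_in_subset_if)
        fix e' u v
        assume "e' \<in> edges H" "snd e' = {u, v}"
        then show "(u, v) \<in> connected_in ?H"
          using is_cycle_connected_without[OF c e(1)] connected_in_edge[of e' ?H u v]
          by (cases "e' = e") auto
      qed
      moreover have "connected_in ?H \<subseteq> connected_in H" by (rule connected_in_mono) auto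
      moreover have "card (edges ?H) < card (edges H)"
        using e less.prems by (simp add: card_Diff1_less del: card_Diff_insert)
      ultimately show ?thesis using less.hyps[of ?H] less.prems by auto
    qed auto
  qed
  from this[OF assms] show ?thesis by (simp add: spanning_forest_def acyclic_mgraph_def conj_ac)
qed

text \<open>The first vertex of a longest simple path has no neighbour outside of the path, and a second
  edge from it to the path would close a cycle.\<close>

lemma acyclic_leaf_exists:
  assumes wf: "wf_mgraph G" and ac: "acyclic_mgraph G" and ne: "verts G \<noteq> {}"
  shows "\<exists>v\<in>verts G. card (incident G v) \<le> 1"
proof -
  define path where "path vs es \<longleftrightarrow> vs \<noteq> [] \<and> distinct vs \<and> set vs \<subseteq> verts G \<and> length vs = Suc (length es) \<and>
     (\<forall>i<length es. es ! i \<in> edges G \<and> snd (es ! i) = {vs ! i, vs ! Suc i})" for vs es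
  obtain v0 where "v0 \<in> verts G" using ne by auto
  then have 1: "path [v0] []" by (simp add: path_def)
  have 2: "length vs \<le> card (verts G)" if "path vs es" for vs es
  proof -
    have "card (set vs) = length vs" "set vs \<subseteq> verts G"
      using that by (auto simp: path_def distinct_card)
    then show ?thesis using wf by (metis card_mono wf_mgraph_def)
  qed
  have "\<exists>p. path (fst p) (snd p) \<and> (\<forall>q. path (fst q) (snd q) \<longrightarrow> length (fst q) \<le> length (fst p))"
    by (rule ex_has_greatest_nat[of _ "([v0], [])" _ "Suc (card (verts G))"]) (use 1 2 in \<open>auto simp: less_Suc_eq_le\<close>)
  then obtain vs es where p: "path vs es"
    and max: "\<And>vs' es'. path vs' es' \<Longrightarrow> length vs' \<le> length vs"
    by force
  from p have vs: "vs \<noteq> []" "distinct vs" "set vs \<subseteq> verts G" "length vs = Suc (length es)"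
    and E: "\<And>i. i < length es \<Longrightarrow> es ! i \<in> edges G \<and> snd (es ! i) = {vs ! i, vs ! Suc i}"
    by (auto simp: path_def)
  define v where "v = vs ! 0"
  have v: "v \<in> verts G" using vs by (auto simp: v_def)
  show ?thesis
  proof (rule ccontr)
    assume "\<not> ?thesis"
    then have "card (incident G v) > 1" using v by auto
    moreover have "finite (incident G v)" using wf by (simp add: wf_mgraph_def incident_def)
    ultimately obtain e where e: "e \<in> incident G v" "es \<noteq> [] \<longrightarrow> e \<noteq> es ! 0"
      by (metis card_le_Suc0_iff_eq One_nat_def leD)
    then have eG: "e \<in> edges G" "v \<in> snd e" by (auto simp: incident_def)
    then obtain w where w: "snd e = {v, w}" "w \<noteq> v" "w \<in> verts G"
      using wf by (auto simp: wf_mgraph_def card_2_iff doubleton_eq_iff dest!: bspec[of _ _ e])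
    show False
    proof (cases "w \<in> set vs")
      case False
      have "path (w # vs) (e # es)"
        unfolding path_def using vs E eG w False
        by (auto simp: nth_Cons v_def insert_commute split: nat.splits)
      then show False using max by fastforce
    next
      case True
      then obtain k where k: "k < length vs" "vs ! k = w" by (auto simp: in_set_conv_nth)
      with w(2) have "k > 0" by (auto simp: v_def intro: gr0I)
      \<comment> \<open>The closed path runs to \<open>w\<close> and returns along \<open>e\<close>.
        For \<open>k = 1\<close> it is the cycle of length two made of \<open>e\<close> and a
        parallel first edge.\<close>
      let ?vs = "take (Suc k) vs" and ?es = "take k es @ [e]"
      have len: "length ?vs = Suc k" "length ?es = Suc k" "k \<le> length es" using k vs by auto
      have ends: "snd (es ! i) = snd (es ! j) \<Longrightarrow> i = j" if "i < length es" "j < length es" for i j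
        using that E[of i] E[of j] vs by (auto simp: doubleton_eq_iff nth_eq_iff_index_eq)
      then have "distinct es" by (metis distinct_conv_nth)
      moreover have "e \<notin> set (take k es)"
      proof
        assume "e \<in> set (take k es)"
        then obtain i where i: "i < k" "es ! i = e" using len by (auto simp: in_set_conv_nth)
        then have "{vs ! i, vs ! Suc i} = {vs ! 0, vs ! k}"
          using E[of i] w k len by (simp add: v_def)
        then have "i = 0" using i vs k by (auto simp: doubleton_eq_iff nth_eq_iff_index_eq)
        then show False using i e len by (cases es) auto
      qed
      moreover have "?es ! i \<in> edges G \<and> snd (?es ! i) = {?vs ! i, ?vs ! (Suc i mod Suc k)}"
        if "i < Suc k" for i
      proof (cases "i = k")
        case True
        then show ?thesis using eG w k len by (simp add: nth_append v_def insert_commute)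
      next
        case False
        then have "i < k" using that by simp
        then show ?thesis using E[of i] len by (simp add: nth_append)
      qed
      ultimately have "is_cycle G ?vs ?es"
        unfolding is_cycle_def len using vs by (simp add: distinct_take)
      then show False using ac by (auto simp: acyclic_mgraph_def)
    qed
  qed
qed

lemma wf_mgraph_remove_vertex: "wf_mgraph G \<Longrightarrow> wf_mgraph (remove_vertex v G)"
  by (fastforce simp: wf_mgraph_def remove_vertex_def)

text \<open>A degree of at most one also admits isolated vertices, so this covers whole forests as
  well as single trees; \<open>acyclic_vertex_sums_zero\<close> is applied to a whole
  forest.\<close>

lemma acyclic_leaf_order_exists:
  assumes "wf_mgraph G" "acyclic_mgraph G"
  shows "\<exists>vs. leaf_order G vs"
  using assms
proof (induction "card (verts G)" arbitrary: G)
  case 0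
  then have "leaf_order G []" by (auto simp: wf_mgraph_def)
  then show ?case ..
next
  case (Suc n)
  then have "verts G \<noteq> {}" by auto
  then obtain v where v: "v \<in> verts G" "card (incident G v) \<le> 1"
    using acyclic_leaf_exists Suc.prems by blast
  have "n = card (verts (remove_vertex v G))"
    using Suc.hyps(2) v by (simp add: remove_vertex_def)
  moreover have "acyclic_mgraph (remove_vertex v G)"
    using Suc.prems(2) by (rule acyclic_mgraph_mono) (auto simp: remove_vertex_def)
  ultimately obtain vs where "leaf_order (remove_vertex v G) vs"
    using Suc.hyps(1)[OF _ wf_mgraph_remove_vertex[OF Suc.prems(1)]] by blast
  then have "leaf_order G (v # vs)" using v by simp
  then show ?case ..
qed

lemma leaf_order_set: "leaf_order G vs \<Longrightarrow> set vs = verts G \<and> distinct vs"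
  by (induction G vs rule: leaf_order.induct) (auto simp: remove_vertex_def)

text \<open>Every edge is counted at both of its ends, hence twice. This is why a right-hand side
  has to sum to zero on a tree.\<close>

lemma sum_vertices_incident:
  fixes y :: "('n, 'e) edge \<Rightarrow> bit"
  assumes "wf_mgraph G"
  shows "(\<Sum>v\<in>verts G. \<Sum>e\<in>incident G v. y e) = 0"
proof -
  have fin: "finite (verts G)" "finite (edges G)" using assms by (auto simp: wf_mgraph_def)
  have "(\<Sum>v\<in>verts G. \<Sum>e\<in>incident G v. y e) = (\<Sum>e\<in>edges G. \<Sum>v\<in>{v\<in>verts G. v \<in> snd e}. y e)"
    unfolding incident_def using fin by (rule sum.swap_restrict)
  also have "\<dots> = 0"
  proof (rule sum.neutral, rule ballI)
    fix e assume "e \<in> edges G"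
    then have "{v\<in>verts G. v \<in> snd e} = snd e" "card (snd e) = 2"
      using assms by (auto simp: wf_mgraph_def)
    then show "(\<Sum>v\<in>{v\<in>verts G. v \<in> snd e}. y e) = 0" by simp
  qed
  finally show ?thesis .
qed

text \<open>Uniqueness of the solution on a forest: the equation at a leaf makes its only edge zero,
  so removing the leaf does not change the sums at the other vertices.\<close>

lemma leaf_order_unique_zero:
  fixes y :: "('n, 'e) edge \<Rightarrow> bit"
  assumes "leaf_order G vs" "wf_mgraph G" "\<And>v. v \<in> verts G \<Longrightarrow> (\<Sum>e\<in>incident G v. y e) = 0" "e \<in> edges G"
  shows "y e = 0"
  using assms
proof (induction G vs arbitrary: e rule: leaf_order.induct)
  case (1 D)
  then show ?case by (auto simp: wf_mgraph_def dest!: bspec[of _ _ e])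
next
  case (2 D v vs)
  let ?D = "remove_vertex v D"
  have fin: "finite (incident D u)" for u using 2(3) by (simp add: wf_mgraph_def incident_def)
  have zero: "y e' = 0" if "e' \<in> incident D v" for e'
  proof -
    have "incident D v = {e'}"
      using that 2(2) fin[of v] card_le_Suc0_iff_eq[of "incident D v"] by auto
    then show ?thesis using 2(4)[of v] 2(2) by auto
  qed
  show ?case
  proof (cases "e \<in> incident D v")
    case False
    have "(\<Sum>e\<in>incident ?D u. y e) = 0" if "u \<in> verts ?D" for u
    proof -
      have "(\<Sum>e\<in>incident ?D u. y e) = (\<Sum>e\<in>incident D u. y e)"
        by (rule sum.mono_neutral_left)
          (use fin zero in \<open>auto simp: incident_def remove_vertex_def\<close>)
      then show ?thesis using 2(4) that by (simp add: remove_vertex_def)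
    qed
    moreover have "e \<in> edges ?D" using False 2(5) by (auto simp: incident_def remove_vertex_def)
    ultimately show ?thesis using 2(1)[of e] 2(2) wf_mgraph_remove_vertex[OF 2(3)] by auto
  qed (rule zero)
qed

text \<open>One equation may be left out, since it follows from the others by
  \<open>sum_vertices_incident\<close>. The vertex \<open>a\<close> will be \<open>Omega\<close>,
  where trees of different dimensions meet.\<close>

lemma acyclic_vertex_sums_zero:
  fixes y :: "('n, 'e) edge \<Rightarrow> bit"
  assumes wf: "wf_mgraph G" and ac: "acyclic_mgraph G" and a: "a \<in> verts G"
    and zero: "\<And>v. v \<in> verts G \<Longrightarrow> v \<noteq> a \<Longrightarrow> (\<Sum>e\<in>incident G v. y e) = 0" and e: "e \<in> edges G"
  shows "y e = 0"
proof -
  obtain vs where vs: "leaf_order G vs" using acyclic_leaf_order_exists wf ac by blast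
  have "finite (verts G)" using wf by (simp add: wf_mgraph_def)
  then have "0 = (\<Sum>e\<in>incident G a. y e) + (\<Sum>v\<in>verts G - {a}. \<Sum>e\<in>incident G v. y e)"
    using a sum_vertices_incident[OF wf, of y] by (subst (asm) sum.remove[of _ a]) auto
  also have "(\<Sum>v\<in>verts G - {a}. \<Sum>e\<in>incident G v. y e) = 0"
    by (rule sum.neutral) (use zero in auto)
  finally have "(\<Sum>e\<in>incident G v. y e) = 0" if "v \<in> verts G" for v
    using zero[OF that] by (cases "v = a") auto
  from leaf_order_unique_zero[OF vs wf this e] show ?thesis by blast
qed

section \<open>TreeSolve\<close>

definition connected_mgraph :: "('n, 'e) mgraph \<Rightarrow> bool" where
  "connected_mgraph G \<longleftrightarrow> (\<forall>u\<in>verts G. \<forall>v\<in>verts G. (u, v) \<in> connected_in G)"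

lemma incident_nonempty_if_connected:
  assumes "connected_mgraph G" "u \<in> verts G" "v \<in> verts G" "u \<noteq> v"
  shows "incident G u \<noteq> {}"
proof -
  have "(u, v) \<in> connected_in G" using assms by (simp add: connected_mgraph_def)
  then obtain w where "(u, w) \<in> {(u, v). \<exists>e\<in>edges G. snd e = {u, v}}"
    unfolding connected_in_def using assms(4) by (meson converse_rtranclE)
  then obtain e where "e \<in> edges G" "snd e = {u, w}" by auto
  then show ?thesis by (cases e) (auto simp: incident_def)
qed

text \<open>The map \<open>f\<close> folds the leaf onto its neighbour \<open>n\<close>. It
  contracts \<open>e\<close> and fixes all other edges, so it turns walks of \<open>G\<close> into
  walks that avoid \<open>v\<close>.\<close>

lemma connected_remove_leaf:
  assumes conn: "connected_mgraph G" and wf: "wf_mgraph G" and inc: "incident G v = {e}"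
  shows "connected_mgraph (remove_vertex v G)"
proof -
  let ?G = "remove_vertex v G"
  have "e \<in> edges G" "v \<in> snd e" using inc by (auto simp: incident_def)
  then obtain n where n: "snd e = {v, n}" "n \<noteq> v"
    using wf by (auto simp: wf_mgraph_def card_2_iff doubleton_eq_iff dest!: bspec[of _ _ e])
  define f where "f w = (if w = v then n else w)" for w
  have *: "(f u, f w) \<in> connected_in ?G" if "(u, w) \<in> connected_in G" for u w
    using that
  proof (induction rule: connected_in_induct)
    case (step a b e')
    have "(f a, f b) \<in> connected_in ?G"
    proof (cases "a = v \<or> b = v")
      case True
      then have "e' \<in> incident G v" using step by (auto simp: incident_def)
      then have "{a, b} = {v, n}" using inc step n by auto
      then have "f a = f b" by (auto simp: f_def doubleton_eq_iff)
      then show ?thesis by simp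
    next
      case False
      then have "e' \<in> edges ?G" using step by (auto simp: remove_vertex_def)
      then show ?thesis using False step by (auto simp: f_def intro: connected_in_edge)
    qed
    then show ?case using step by (blast intro: connected_in_trans)
  qed simp
  show ?thesis
    unfolding connected_mgraph_def
  proof (intro ballI)
    fix a b
    assume "a \<in> verts ?G" "b \<in> verts ?G"
    then have "(a, b) \<in> connected_in G" "a \<noteq> v" "b \<noteq> v"
      using conn by (auto simp: remove_vertex_def connected_mgraph_def)
    then show "(a, b) \<in> connected_in ?G" using *[of a b] by (simp add: f_def)
  qed
qed

text \<open>The first conjunct keeps the equation at \<open>v\<close> true once it holds: later
  rounds change only edges of \<open>remove_vertex v D\<close>, and none of these meets
  \<open>v\<close>. The last vertex is missing from the second conjunct because no edge is assigned
  there.\<close>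

lemma tree_solve_loop_correct:
  assumes "leaf_order D vs" "wf_mgraph D" "connected_mgraph D" "finite (edges C)"
    and "verts D \<subseteq> verts C" "edges D = {e \<in> edges C. snd e \<subseteq> verts D}"
  shows "(\<forall>e. e \<notin> edges D \<longrightarrow> tree_solve_loop C b D vs x e = x e) \<and>
    (\<forall>v\<in>set (butlast vs). (\<Sum>e\<in>incident C v. tree_solve_loop C b D vs x e) = b v)"
  using assms
proof (induction C b D vs x rule: tree_solve_loop.induct)
  case (3 C b D v w vs x)
  let ?D = "remove_vertex v D"
  have lo: "v \<in> verts D" "card (incident D v) \<le> 1" "leaf_order ?D (w # vs)"
    using "3.prems"(1) by auto
  have fin: "finite (incident D v)" using "3.prems"(2) by (simp add: wf_mgraph_def incident_def)
  have "w \<in> verts D" "w \<noteq> v" using lo(3) by (auto simp: remove_vertex_def)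
  then have "incident D v \<noteq> {}"
    using incident_nonempty_if_connected "3.prems"(3) lo(1) by metis
  \<comment> \<open>At most one edge by the leaf order, at least one by connectivity, since
    \<open>w\<close> is another vertex of \<open>D\<close>. This makes the \<open>THE\<close> of the
    loop meaningful.\<close>
  then obtain e where e: "incident D v = {e}"
    using lo(2) fin by (metis One_nat_def card_1_singletonE card_0_eq le_SucE le_zero_eq)
  then have the: "(THE e. e \<in> incident D v) = e" by simp
  have eD: "e \<in> edges D" "v \<in> snd e" using e by (auto simp: incident_def)
  define x1 where "x1 = x(e := b v + (\<Sum>e'\<in>incident C v - {e}. x e'))"
  define x' where "x' = tree_solve_loop C b ?D (w # vs) x1"
  have res: "tree_solve_loop C b D (v # w # vs) x = x'"
    by (simp add: Let_def the x'_def x1_def)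
  have D': "verts ?D \<subseteq> verts C" "edges ?D = {e \<in> edges C. snd e \<subseteq> verts ?D}"
    using "3.prems"(5,6) by (auto simp: remove_vertex_def)
  have IH: "\<And>e. e \<notin> edges ?D \<Longrightarrow> x' e = x1 e"
    "\<And>u. u \<in> set (butlast (w # vs)) \<Longrightarrow> (\<Sum>e\<in>incident C u. x' e) = b u"
    using "3.IH"[OF refl, unfolded the, folded x1_def, folded x'_def, OF lo(3)
        wf_mgraph_remove_vertex[OF "3.prems"(2)] connected_remove_leaf[OF "3.prems"(3,2) e] "3.prems"(4) D']
    by auto
  have "x' e' = x e'" if "e' \<notin> edges D" for e'
  proof -
    have "e' \<notin> edges ?D" "e' \<noteq> e" using that eD by (auto simp: remove_vertex_def)
    then show ?thesis using IH(1) by (simp add: x1_def)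
  qed
  moreover have "(\<Sum>e\<in>incident C v. x' e) = b v"
  proof -
    have "e \<in> incident C v" using eD "3.prems"(6) by (auto simp: incident_def)
    moreover have "finite (incident C v)" using "3.prems"(4) by (simp add: incident_def)
    moreover have "(\<Sum>e\<in>incident C v. x' e) = (\<Sum>e\<in>incident C v. x1 e)"
      by (rule sum.cong) (auto simp: incident_def remove_vertex_def intro!: IH(1))
    ultimately have "(\<Sum>e\<in>incident C v. x' e) = x1 e + (\<Sum>e'\<in>incident C v - {e}. x1 e')"
      by (simp add: sum.remove)
    also have "(\<Sum>e'\<in>incident C v - {e}. x1 e') = (\<Sum>e'\<in>incident C v - {e}. x e')"
      by (rule sum.cong) (auto simp: x1_def)
    finally show ?thesis by (simp add: x1_def add.assoc)
  qed
  ultimately show ?case using IH(2) unfolding res by auto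
qed auto

text \<open>The equation at the last vertex comes for free: both the vertex sums of \<open>x\<close>
  and the values of \<open>b\<close> add up to zero over the tree, and they agree at all other
  vertices.\<close>

lemma tree_solve_correct:
  assumes ts: "tree_solve C b x" and wf: "wf_mgraph C" and conn: "connected_mgraph C"
    and bal: "(\<Sum>v\<in>verts C. b v) = 0" and v: "v \<in> verts C"
  shows "(\<Sum>e\<in>incident C v. x e) = b v"
proof -
  obtain vs where vs: "leaf_order C vs" "x = tree_solve_loop C b C vs (\<lambda>_. 0)"
    using ts by (auto simp: tree_solve_def)
  have fin: "finite (edges C)" "finite (verts C)" using wf by (auto simp: wf_mgraph_def)
  have E: "edges C = {e \<in> edges C. snd e \<subseteq> verts C}" using wf by (auto simp: wf_mgraph_def)
  have *: "(\<Sum>e\<in>incident C u. x e) = b u" if "u \<in> set (butlast vs)" for u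
    using tree_solve_loop_correct[OF vs(1) wf conn fin(1) order_refl E] that vs(2) by auto
  have set: "set vs = verts C" "distinct vs" using leaf_order_set[OF vs(1)] by auto
  then have ne: "vs \<noteq> []" using v by auto
  then have split: "set vs = insert (last vs) (set (butlast vs))"
    by (metis append_butlast_last_id set_append Un_insert_right list.simps(15) sup_bot_right empty_set)
  have notin: "last vs \<notin> set (butlast vs)"
    using set(2) ne by (metis append_butlast_last_id distinct_append disjoint_insert(1) empty_set list.simps(15) inf_commute)
  have "(\<Sum>u\<in>set vs. (\<Sum>e\<in>incident C u. x e)) = (\<Sum>u\<in>set vs. b u)"
    using sum_vertices_incident[OF wf, of x] bal set by simp
  moreover have "(\<Sum>u\<in>set (butlast vs). (\<Sum>e\<in>incident C u. x e)) = (\<Sum>u\<in>set (butlast vs). b u)"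
    by (rule sum.cong) (use * in auto)
  ultimately have "(\<Sum>e\<in>incident C (last vs). x e) = b (last vs)"
    unfolding split using notin by simp
  then show ?thesis using *[of v] v set(1) split by (cases "v = last vs") auto
qed

lemma tree_solve_exists:
  assumes "wf_mgraph C" "acyclic_mgraph C"
  shows "\<exists>x. tree_solve C b x"
  using acyclic_leaf_order_exists[OF assms] by (auto simp: tree_solve_def)

section \<open>Components\<close>

lemma verts_component: "verts (component G v) = {w. (v, w) \<in> connected_in G}"
  and edges_component: "edges (component G v) = {e \<in> edges G. snd e \<subseteq> {w. (v, w) \<in> connected_in G}}"
  by (simp_all add: component_def Let_def)

lemma component_eq_if_connected:
  assumes "(u, v) \<in> connected_in G"
  shows "component G u = component G v"
proof -
  have "{w. (u, w) \<in> connected_in G} = {w. (v, w) \<in> connected_in G}"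
    using assms by (auto intro: connected_in_trans connected_in_sym)
  then show ?thesis by (simp add: component_def)
qed

lemma verts_component_subset: "wf_mgraph G \<Longrightarrow> v \<in> verts G \<Longrightarrow> verts (component G v) \<subseteq> verts G"
  by (auto simp: verts_component intro: connected_in_verts)

lemma edge_in_component:
  assumes "wf_mgraph G" "e \<in> edges G" "v \<in> snd e"
  shows "e \<in> edges (component G v)"
proof -
  obtain w where "snd e = {v, w}"
    using assms by (auto simp: wf_mgraph_def card_2_iff doubleton_eq_iff dest!: bspec[of _ _ e])
  then show ?thesis using assms(2) connected_in_edge[of e G v w] by (auto simp: edges_component)
qed

lemma incident_component: "wf_mgraph G \<Longrightarrow> incident (component G v) v = incident G v"
  by (auto simp: incident_def dest: edge_in_component) (simp add: edges_component)

lemma wf_component: "wf_mgraph G \<Longrightarrow> v \<in> verts G \<Longrightarrow> wf_mgraph (component G v)"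
  using verts_component_subset[of G v]
  by (auto simp: wf_mgraph_def edges_component verts_component intro: finite_subset)

lemma acyclic_component: "acyclic_mgraph G \<Longrightarrow> acyclic_mgraph (component G v)"
  by (erule acyclic_mgraph_mono) (auto simp: edges_component)

lemma connected_component: "connected_mgraph (component G v)"
proof -
  have *: "(v, w) \<in> connected_in (component G v)" if "(v, w) \<in> connected_in G" for w
    using that
  proof (induction rule: connected_in_induct)
    case (step a b e)
    then have "(v, b) \<in> connected_in G" by (meson connected_in_trans connected_in_edge)
    then have "e \<in> edges (component G v)" using step by (auto simp: edges_component)
    then show ?case using step by (meson connected_in_trans connected_in_edge)
  qed simp
  show ?thesis
    unfolding connected_mgraph_def verts_component
    using connected_in_trans[OF connected_in_sym[OF *] *] by blast
qed

text \<open>Allows the solutions on the trees to be glued to one function on the edges of the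
  forest.\<close>

lemma components_edge_unique:
  assumes "wf_mgraph G" "C \<in> components G" "C' \<in> components G" "e \<in> edges C" "e \<in> edges C'"
  shows "C = C'"
proof -
  obtain u v where "C = component G u" "C' = component G v"
    using assms by (auto simp: components_def)
  moreover obtain a where "a \<in> snd e"
    using assms(1,4) \<open>C = component G u\<close> by (fastforce simp: edges_component wf_mgraph_def card_2_iff)
  ultimately have "(u, a) \<in> connected_in G" "(v, a) \<in> connected_in G"
    using assms(4,5) by (auto simp: edges_component)
  then have "(u, v) \<in> connected_in G" using connected_in_sym connected_in_trans by metis
  then show ?thesis using \<open>C = _\<close> \<open>C' = _\<close> component_eq_if_connected by metis
qed

section \<open>Simplicial boundaries modulo 2\<close>

text \<open>Facets are indexed by the opposite vertex. The case distinction is the unaugmented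
  convention: deleting the only vertex of a simplex would leave the empty set.\<close>

lemma facets_eq:
  assumes "finite \<sigma>"
  shows "facets \<sigma> = (if card \<sigma> \<ge> 2 then (\<lambda>v. \<sigma> - {v}) ` \<sigma> else {})"
proof -
  have "\<tau> \<in> facets \<sigma> \<longleftrightarrow> card \<sigma> \<ge> 2 \<and> (\<exists>v\<in>\<sigma>. \<tau> = \<sigma> - {v})" for \<tau>
  proof
    assume "\<tau> \<in> facets \<sigma>"
    then have t: "\<tau> \<subseteq> \<sigma>" "\<tau> \<noteq> {}" "Suc (card \<tau>) = card \<sigma>" by (auto simp: facets_def sdim_def)
    then have "finite \<tau>" using assms by (auto intro: finite_subset)
    then have "card (\<sigma> - \<tau>) = 1" using t by (simp add: card_Diff_subset flip: t(3))
    then obtain v where "\<sigma> - \<tau> = {v}" by (auto simp: card_1_singleton_iff)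
    then have "v \<in> \<sigma>" "\<tau> = \<sigma> - {v}" using t by auto
    moreover have "card \<tau> > 0" using t \<open>finite \<tau>\<close> by (simp add: card_gt_0_iff)
    ultimately show "card \<sigma> \<ge> 2 \<and> (\<exists>v\<in>\<sigma>. \<tau> = \<sigma> - {v})" using t by auto
  next
    assume r: "card \<sigma> \<ge> 2 \<and> (\<exists>v\<in>\<sigma>. \<tau> = \<sigma> - {v})"
    then have "card \<tau> = card \<sigma> - 1" using assms by auto
    moreover from this r have "\<tau> \<noteq> {}" by auto
    ultimately show "\<tau> \<in> facets \<sigma>" using r by (auto simp: facets_def sdim_def)
  qed
  then show ?thesis by auto
qed

lemma sum_facets:
  assumes "finite \<sigma>"
  shows "(\<Sum>\<tau>\<in>facets \<sigma>. f \<tau>) = (if card \<sigma> \<ge> 2 then (\<Sum>v\<in>\<sigma>. f (\<sigma> - {v})) else 0)"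
proof -
  have "inj_on (\<lambda>v. \<sigma> - {v}) \<sigma>" by (auto simp: inj_on_def)
  then show ?thesis by (simp add: facets_eq[OF assms] sum.reindex)
qed

text \<open>The pairs \<open>(v, w)\<close> and \<open>(w, v)\<close> cancel modulo 2.\<close>

lemma sum_offdiag_symmetric_zero:
  fixes a :: "'v \<Rightarrow> 'v \<Rightarrow> bit"
  assumes "finite S" "\<And>v w. a v w = a w v"
  shows "(\<Sum>v\<in>S. \<Sum>w\<in>S - {v}. a v w) = 0"
  using assms(1)
proof induction
  case (insert z S)
  have "(\<Sum>w\<in>insert z S - {v}. a v w) = a z v + (\<Sum>w\<in>S - {v}. a v w)" if "v \<in> S" for v
  proof -
    have "insert z S - {v} = insert z (S - {v})" using that insert.hyps by auto
    then show ?thesis using insert.hyps assms(2)[of v z] by simp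
  qed
  then have "(\<Sum>v\<in>S. \<Sum>w\<in>insert z S - {v}. a v w) = (\<Sum>v\<in>S. a z v) + (\<Sum>v\<in>S. \<Sum>w\<in>S - {v}. a v w)"
    by (simp add: sum.distrib)
  then show ?case using insert by (simp add: sum.insert)
qed simp

text \<open>The double boundary is evaluated on an arbitrary cochain \<open>H\<close>. Deleting
  \<open>v\<close> and then \<open>w\<close> leaves the same face as deleting them in the other
  order.\<close>

lemma boundary_boundary:
  fixes H :: "'v set \<Rightarrow> bit"
  assumes "finite \<sigma>"
  shows "(\<Sum>\<tau>\<in>facets \<sigma>. \<Sum>\<kappa>\<in>facets \<tau>. H \<kappa>) = 0"
proof (cases "card \<sigma> \<ge> 3")
  case True
  have "(\<Sum>\<kappa>\<in>facets (\<sigma> - {v}). H \<kappa>) = (\<Sum>w\<in>\<sigma> - {v}. H (\<sigma> - {v, w}))" if "v \<in> \<sigma>" for v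
  proof -
    have "card (\<sigma> - {v}) \<ge> 2" using True that assms by simp
    moreover have "\<sigma> - {v} - {w} = \<sigma> - {v, w}" for w by auto
    ultimately show ?thesis using assms by (simp add: sum_facets)
  qed
  then show ?thesis
    using assms sum_offdiag_symmetric_zero[of \<sigma> "\<lambda>v w. H (\<sigma> - {v, w})"]
    by (simp add: sum_facets insert_commute)
next
  case False
  \<comment> \<open>A simplex with at most two vertices has no facet that has facets itself.\<close>
  then have "(\<Sum>\<kappa>\<in>facets (\<sigma> - {v}). H \<kappa>) = 0" if "v \<in> \<sigma>" for v
    using that assms by (simp add: sum_facets)
  then show ?thesis using assms by (simp add: sum_facets)
qed

text \<open>If \<open>f\<close> identifies two vertices of \<open>\<sigma>\<close>, only the two facets opposite to them can survive, and
  they have the same image.\<close>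

lemma boundary_image:
  fixes H :: "'v set \<Rightarrow> bit"
  assumes fin: "finite \<sigma>"
  shows "(\<Sum>\<tau>\<in>facets \<sigma>. if inj_on f \<tau> then H (f ` \<tau>) else 0) =
    (if inj_on f \<sigma> then (\<Sum>\<tau>\<in>facets (f ` \<sigma>). H \<tau>) else 0)"
proof (cases "inj_on f \<sigma>")
  case True
  have "inj_on f (\<sigma> - {v})" for v using True by (auto simp: inj_on_def)
  moreover have "f ` \<sigma> - {f v} = f ` (\<sigma> - {v})" if "v \<in> \<sigma>" for v
    using True that by (auto simp: inj_on_def)
  ultimately show ?thesis
    using True fin by (simp add: sum_facets card_image sum.reindex)
next
  case False
  then obtain u w where uw: "u \<in> \<sigma>" "w \<in> \<sigma>" "u \<noteq> w" "f u = f w" by (auto simp: inj_on_def)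
  have "card {u, w} \<le> card \<sigma>" using uw fin by (intro card_mono) auto
  then have 2: "card \<sigma> \<ge> 2" using uw by simp
  define q where "q v = (if inj_on f (\<sigma> - {v}) then H (f ` (\<sigma> - {v})) else 0)" for v
  have q0: "q v = 0" if "v \<noteq> u" "v \<noteq> w" for v
    using that uw by (auto simp: q_def inj_on_def)
  have "f ` (\<sigma> - {a}) = f ` \<sigma>" if "a \<in> \<sigma>" "b \<in> \<sigma> - {a}" "f a = f b" for a b
    using that by (metis image_eqI image_insert insert_Diff insert_absorb)
  from this[of u w] this[of w u] have im: "f ` (\<sigma> - {u}) = f ` (\<sigma> - {w})" using uw by auto
  \<comment> \<open>The two sets have the same cardinality and the same image, so \<open>f\<close>
    is injective on both or on neither.\<close>
  have "inj_on f (\<sigma> - {u}) \<longleftrightarrow> inj_on f (\<sigma> - {w})"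
  proof -
    have "card (\<sigma> - {u}) = card (\<sigma> - {w})" using uw fin by simp
    then show ?thesis using fin im by (metis card_image eq_card_imp_inj_on finite_Diff)
  qed
  then have "q u = q w" using im by (simp add: q_def)
  have "(\<Sum>v\<in>\<sigma>. q v) = (\<Sum>v\<in>{u, w}. q v)"
    by (rule sum.mono_neutral_right) (use fin uw q0 in auto)
  also have "\<dots> = 0" using uw \<open>q u = q w\<close> by simp
  finally show ?thesis using False fin 2 by (simp add: sum_facets q_def)
qed

section \<open>Generators and relations\<close>

declare split_paired_All [simp del] split_paired_Ex [simp del]

locale finite_poset_tower =
  fixes P :: "'p::order set" and K :: "('p, 'v) tower"
  assumes finite_P: "finite P" and tower: "poset_tower P K"
begin

lemma cpx_face: "x \<in> P \<Longrightarrow> \<sigma> \<in> cpx K x \<Longrightarrow> \<tau> \<subseteq> \<sigma> \<Longrightarrow> \<tau> \<noteq> {} \<Longrightarrow> \<tau> \<in> cpx K x"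
  and cpx_simplex_finite: "x \<in> P \<Longrightarrow> \<sigma> \<in> cpx K x \<Longrightarrow> finite \<sigma>"
  and cpx_simplex_nonempty: "x \<in> P \<Longrightarrow> \<sigma> \<in> cpx K x \<Longrightarrow> \<sigma> \<noteq> {}"
  and cpx_finite: "x \<in> P \<Longrightarrow> finite (cpx K x)"
proof -
  have "fin_simplicial_complex (cpx K x)" if "x \<in> P" for x
    using tower that by (simp add: poset_tower_def)
  then show "x \<in> P \<Longrightarrow> \<sigma> \<in> cpx K x \<Longrightarrow> \<tau> \<subseteq> \<sigma> \<Longrightarrow> \<tau> \<noteq> {} \<Longrightarrow> \<tau> \<in> cpx K x"
    "x \<in> P \<Longrightarrow> \<sigma> \<in> cpx K x \<Longrightarrow> finite \<sigma>" "x \<in> P \<Longrightarrow> \<sigma> \<in> cpx K x \<Longrightarrow> \<sigma> \<noteq> {}"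
    "x \<in> P \<Longrightarrow> finite (cpx K x)"
    unfolding fin_simplicial_complex_def by blast+
qed

lemma cpx_vertex: "x \<in> P \<Longrightarrow> \<sigma> \<in> cpx K x \<Longrightarrow> v \<in> \<sigma> \<Longrightarrow> {v} \<in> cpx K x"
  by (rule cpx_face) auto

lemma cpx_image: "x \<in> P \<Longrightarrow> y \<in> P \<Longrightarrow> x \<le> y \<Longrightarrow> \<sigma> \<in> cpx K x \<Longrightarrow> vmap K x y ` \<sigma> \<in> cpx K y"
  using tower unfolding poset_tower_def by blast

lemma vmap_id: "x \<in> P \<Longrightarrow> \<sigma> \<in> cpx K x \<Longrightarrow> v \<in> \<sigma> \<Longrightarrow> vmap K x x v = v"
  using tower cpx_vertex[of x \<sigma> v] unfolding poset_tower_def by blast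

lemma vmap_comp:
  assumes "x \<in> P" "y \<in> P" "z \<in> P" "x \<le> y" "y \<le> z" "\<sigma> \<in> cpx K x" "v \<in> \<sigma>"
  shows "vmap K x z v = vmap K y z (vmap K x y v)"
  using tower assms cpx_vertex[of x \<sigma> v] unfolding poset_tower_def by blast

definition gens_upto :: "'p \<Rightarrow> ('p, 'v) gen set" where
  "gens_upto x = {g \<in> generators P K. fst g \<le> x}"

text \<open>With \<open>image_at\<close> this describes the map from the projective modules to the
  simplicial chains of the tower: at grade \<open>x\<close> a generator goes to its image simplex if
  it is alive, and to zero if it has become degenerate.\<close>

definition alive :: "'p \<Rightarrow> ('p, 'v) gen \<Rightarrow> bool" where
  "alive x g \<longleftrightarrow> inj_on (vmap K (fst g) x) (snd g)"

definition image_at :: "'p \<Rightarrow> ('p, 'v) gen \<Rightarrow> 'v set" where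
  "image_at x g = vmap K (fst g) x ` snd g"

lemma gens_uptoD:
  assumes "g \<in> gens_upto x"
  shows "g \<in> generators P K" "fst g \<in> P" "fst g \<le> x" "snd g \<in> cpx K (fst g)"
  using assms by (auto simp: gens_upto_def generators_def)

lemma generatorsD:
  assumes "g \<in> generators P K"
  shows "g \<in> gens_upto (fst g)" "fst g \<in> P" "snd g \<in> cpx K (fst g)"
  using assms by (auto simp: gens_upto_def generators_def)

lemma finite_generators: "finite (generators P K)"
  by (rule finite_subset[of _ "Sigma P (cpx K)"])
    (auto simp: generators_def finite_P cpx_finite)

lemma finite_gens_upto: "finite (gens_upto x)"
  using finite_generators by (simp add: gens_upto_def)

lemma gens_upto_mono: "g \<in> gens_upto y \<Longrightarrow> y \<le> x \<Longrightarrow> g \<in> gens_upto x"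
  by (auto simp: gens_upto_def)

lemma finite_gen: "g \<in> gens_upto x \<Longrightarrow> finite (snd g)"
  using cpx_simplex_finite gens_uptoD by blast

lemma image_at_cpx: "g \<in> gens_upto x \<Longrightarrow> x \<in> P \<Longrightarrow> image_at x g \<in> cpx K x"
  unfolding image_at_def by (intro cpx_image) (auto dest: gens_uptoD)

lemma image_at_comp:
  assumes "g \<in> gens_upto y" "y \<le> x" "x \<in> P" "y \<in> P"
  shows "image_at x g = vmap K y x ` image_at y g"
  using vmap_comp[of "fst g" y x "snd g"] gens_uptoD[OF assms(1)] assms
  by (auto simp: image_at_def image_image)

text \<open>An injective composite is injective in its first factor, so a generator that has become
  degenerate never revives.\<close>

lemma alive_comp:
  assumes "g \<in> gens_upto y" "y \<le> x" "x \<in> P" "y \<in> P"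
  shows "alive x g \<longleftrightarrow> alive y g \<and> inj_on (vmap K y x) (image_at y g)"
proof -
  have "alive x g \<longleftrightarrow> inj_on (vmap K y x \<circ> vmap K (fst g) y) (snd g)"
    unfolding alive_def using vmap_comp[of "fst g" y x "snd g"] gens_uptoD[OF assms(1)] assms
    by (intro inj_on_cong) auto
  then show ?thesis
    by (auto simp: alive_def image_at_def intro: comp_inj_on dest: inj_on_imageI inj_on_imageI2)
qed

lemma alive_self: "g \<in> generators P K \<Longrightarrow> alive (fst g) g"
  and image_at_self: "g \<in> generators P K \<Longrightarrow> image_at (fst g) g = snd g"
  using vmap_id[of "fst g" "snd g"] generatorsD[of g]
  by (auto simp: alive_def image_at_def inj_on_def)

lemma sdim_image_at: "alive x g \<Longrightarrow> sdim (image_at x g) = sdim (snd g)"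
  by (simp add: alive_def image_at_def sdim_def card_image)

text \<open>The two forms come from Collapse and from merging. Either way the column is sent to zero
  in the chains of the complex at the grade of \<open>r\<close>.\<close>

definition relation_ok :: "(('p, 'v) gen, 'p rid) mat \<Rightarrow> 'p rid \<Rightarrow> bool" where
  "relation_ok p r \<longleftrightarrow>
     (\<exists>g\<in>gens_upto (fst r). \<not> alive (fst r) g \<and> (\<forall>h. p h r = of_bool (h = g))) \<or>
     (\<exists>g\<in>gens_upto (fst r). \<exists>g'\<in>gens_upto (fst r). g \<noteq> g' \<and> alive (fst r) g \<and> alive (fst r) g' \<and>
        image_at (fst r) g = image_at (fst r) g' \<and> (\<forall>h. p h r = of_bool (h = g \<or> h = g')))"

text \<open>The column lifts the boundary of the simplex: at the grade of \<open>g\<close> its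
  entries are alive and represent the facets, although they may have been born earlier with other
  labels.\<close>

definition boundary_ok :: "(('p, 'v) gen, ('p, 'v) gen) mat \<Rightarrow> ('p, 'v) gen \<Rightarrow> bool" where
  "boundary_ok f g \<longleftrightarrow> (\<exists>\<phi>.
     (\<forall>\<tau>\<in>facets (snd g). \<phi> \<tau> \<in> gens_upto (fst g) \<and> alive (fst g) (\<phi> \<tau>) \<and> image_at (fst g) (\<phi> \<tau>) = \<tau>) \<and>
     (\<forall>h. f h g = of_bool (h \<in> \<phi> ` facets (snd g))))"

lemma relation_ok_support:
  assumes "relation_ok p r" "p g r \<noteq> 0"
  shows "g \<in> gens_upto (fst r)"
  using assms by (auto simp: relation_ok_def split: if_splits)

text \<open>Makes the degree of a relation well defined: merged generators share the dimension of
  their common image.\<close>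

lemma relation_ok_dim:
  assumes "relation_ok p r" "p g r \<noteq> 0" "p h r \<noteq> 0"
  shows "sdim (snd g) = sdim (snd h)"
  using assms(1) unfolding relation_ok_def
proof (elim disjE bexE conjE)
  fix k k'
  assume k: "alive (fst r) k" "alive (fst r) k'" "image_at (fst r) k = image_at (fst r) k'"
    "\<forall>h. p h r = of_bool (h = k \<or> h = k')"
  then have "sdim (snd k) = sdim (snd k')" by (metis sdim_image_at)
  moreover have "g \<in> {k, k'}" "h \<in> {k, k'}" using assms(2,3) k(4) by (auto split: if_splits)
  ultimately show ?thesis by auto
qed (use assms(2,3) in \<open>auto split: if_splits\<close>)

lemma boundary_ok_support:
  assumes "boundary_ok f g" "f h g \<noteq> 0"
  shows "h \<in> gens_upto (fst g)" "sdim (snd h) = sdim (snd g) - 1"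
proof -
  obtain \<phi> where \<phi>: "\<And>\<tau>. \<tau> \<in> facets (snd g) \<Longrightarrow>
      \<phi> \<tau> \<in> gens_upto (fst g) \<and> alive (fst g) (\<phi> \<tau>) \<and> image_at (fst g) (\<phi> \<tau>) = \<tau>"
    "\<And>h. f h g = of_bool (h \<in> \<phi> ` facets (snd g))"
    using assms(1) unfolding boundary_ok_def by blast
  then obtain \<tau> where "\<tau> \<in> facets (snd g)" "h = \<phi> \<tau>" using assms(2) by (auto split: if_splits)
  then show "h \<in> gens_upto (fst g)" "sdim (snd h) = sdim (snd g) - 1"
    using \<phi>(1)[of \<tau>] sdim_image_at[of "fst g" h] by (auto simp: facets_def)
qed

section \<open>Invariants\<close>

text \<open>The last clause makes the columns of \<open>p\<close> named by the edges an incidence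
  matrix without the row of \<open>Omega\<close>: an edge at \<open>Omega\<close> is a column with a
  single entry.\<close>

definition graph_ok ::
  "'p rid set \<Rightarrow> (('p, 'v) gen, 'p rid) mat \<Rightarrow> 'p \<Rightarrow> (('p, 'v) node, 'p rid) mgraph \<Rightarrow> bool" where
  "graph_ok R p x G \<longleftrightarrow> wf_mgraph G \<and> Omega \<in> verts G \<and> verts G \<subseteq> insert Omega (Gen ` gens_upto x) \<and>
     (\<forall>e\<in>edges G. fst e \<in> R \<and> fst (fst e) \<le> x \<and> (\<forall>g. p g (fst e) = of_bool (Gen g \<in> snd e)))"

definition act_ok :: "'p \<Rightarrow> ('v set \<times> ('p, 'v) gen) set \<Rightarrow> bool" where
  "act_ok x A \<longleftrightarrow> (\<forall>(\<sigma>, g)\<in>A. g \<in> gens_upto x \<and> alive x g \<and> image_at x g = \<sigma>)"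

definition represents ::
  "'p \<Rightarrow> ('v set \<times> ('p, 'v) gen) set \<Rightarrow> (('p, 'v) node, 'p rid) mgraph \<Rightarrow> ('p, 'v) gen \<Rightarrow> bool" where
  "represents x A G g \<longleftrightarrow>
     (if alive x g then \<exists>g'. (image_at x g, g') \<in> A \<and> (Gen g, Gen g') \<in> connected_in G
      else (Gen g, Omega) \<in> connected_in G)"

definition grade_ok :: "('p, 'v) state \<Rightarrow> 'p \<Rightarrow> bool" where
  "grade_ok s x \<longleftrightarrow> graph_ok (rels s) (p1 s) x (forest s x) \<and> acyclic_mgraph (forest s x) \<and>
     Gen ` gens_upto x \<subseteq> verts (forest s x) \<and> act_ok x (act s x) \<and>
     (\<forall>\<sigma>\<in>cpx K x. \<exists>g. (\<sigma>, g) \<in> act s x) \<and>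
     (\<forall>\<sigma> g g'. (\<sigma>, g) \<in> act s x \<longrightarrow> (\<sigma>, g') \<in> act s x \<longrightarrow> g = g') \<and>
     (\<forall>g\<in>gens_upto x. represents x (act s x) (forest s x) g)"

text \<open>Stated with the matrices of the current state, although the columns were computed at an
  earlier one; \<open>processed_frame\<close> shows that later grades do not change the
  products.\<close>

definition lifted :: "('p, 'v) state \<Rightarrow> 'p \<Rightarrow> bool" where
  "lifted s x \<longleftrightarrow>
     (\<forall>r\<in>rels s. fst r = x \<longrightarrow> lift_column P K (forest s x)
        (\<lambda>g. mat_mult (generators P K) (f0 s) (p1 s) g r) (\<lambda>r'. f1 s r' r)) \<and>
     (\<forall>g\<in>generators P K. fst g = x \<longrightarrow> lift_column P K (forest s x)
        (\<lambda>h. mat_mult (generators P K) (f0 s) (f0 s) h g) (\<lambda>r'. theta s r' g))"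

definition rels_ok :: "'p set \<Rightarrow> ('p, 'v) state \<Rightarrow> bool" where
  "rels_ok D s \<longleftrightarrow> finite (rels s) \<and> (\<forall>r\<in>rels s. fst r \<in> D \<and> relation_ok (p1 s) r)"

definition processed :: "'p set \<Rightarrow> ('p, 'v) state \<Rightarrow> bool" where
  "processed D s \<longleftrightarrow> rels_ok D s \<and> (\<forall>g\<in>generators P K. fst g \<in> D \<longrightarrow> boundary_ok (f0 s) g) \<and>
     (\<forall>x\<in>D. grade_ok s x \<and> lifted s x)"

text \<open>TreeSolve assigns values to edges, but the rows of \<open>f1\<close> and
  \<open>theta\<close> are labels. A label determines its edge because the column of
  \<open>p\<close> shows which generators are its ends.\<close>

lemma inj_on_labels:
  assumes "graph_ok R p x G"
  shows "inj_on fst (edges G)"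
proof (rule inj_onI)
  fix e e'
  assume e: "e \<in> edges G" "e' \<in> edges G" "fst e = fst e'"
  have "p g (fst e') = of_bool (Gen g \<in> snd e')" if "e' \<in> edges G" for e' g
    using assms that by (simp add: graph_ok_def)
  then have G: "Gen g \<in> snd e \<longleftrightarrow> Gen g \<in> snd e'" for g
    using e by (metis of_bool_eq_iff)
  then have "n \<in> snd e - {Omega} \<longleftrightarrow> n \<in> snd e' - {Omega}" for n
    by (cases n) auto
  then have *: "snd e - {Omega} = snd e' - {Omega}" by blast
  have c: "card (snd e) = 2" "card (snd e') = 2"
    using assms e by (auto simp: graph_ok_def wf_mgraph_def)
  then have "finite (snd e)" "finite (snd e')" by (auto intro: card_ge_0_finite)
  \<comment> \<open>An edge has two ends, so \<open>Omega\<close> is one of them exactly if only one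
    end is a generator.\<close>
  then have "Omega \<in> snd e \<longleftrightarrow> Omega \<in> snd e'"
    using arg_cong[OF *, of card] c by (auto simp: card_Diff_singleton_if split: if_splits)
  then have "snd e = snd e'" using * by blast
  then show "e = e'" using e(3) by (simp add: prod_eq_iff)
qed

section \<open>Correctness of the lift\<close>

definition balanced :: "(('p, 'v) node, 'p rid) mgraph \<Rightarrow> (('p, 'v) gen \<Rightarrow> bit) \<Rightarrow> bool" where
  "balanced F c \<longleftrightarrow> (\<forall>h. (\<forall>m n. (m, n) \<in> connected_in F \<longrightarrow> h m = h n) \<longrightarrow> h Omega = 0 \<longrightarrow>
     (\<Sum>g\<in>generators P K. c g * h (Gen g)) = (0::bit))"

text \<open>The chain map property in dual form: if \<open>h\<close> comes from a cochain
  \<open>H\<close> at grade \<open>x\<close>, its pairing with a column of \<open>f\<close> is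
  \<open>H\<close> evaluated on the boundary of the image simplex, by
  \<open>boundary_image\<close>.\<close>

lemma boundary_pairing:
  fixes h :: "('p, 'v) node \<Rightarrow> bit" and H :: "'v set \<Rightarrow> bit"
  assumes x: "x \<in> P" and g: "g \<in> gens_upto x" and bd: "boundary_ok f g"
    and H: "\<And>k. k \<in> gens_upto x \<Longrightarrow> h (Gen k) = (if alive x k then H (image_at x k) else 0)"
  shows "(\<Sum>k\<in>generators P K. f k g * h (Gen k)) =
    (if alive x g then (\<Sum>\<tau>\<in>facets (image_at x g). H \<tau>) else 0)"
proof -
  let ?z = "fst g"
  note gD = gens_uptoD[OF g]
  obtain \<phi> where \<phi>: "\<And>\<tau>. \<tau> \<in> facets (snd g) \<Longrightarrow>
      \<phi> \<tau> \<in> gens_upto ?z \<and> alive ?z (\<phi> \<tau>) \<and> image_at ?z (\<phi> \<tau>) = \<tau>"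
    "\<And>h. f h g = of_bool (h \<in> \<phi> ` facets (snd g))"
    using bd unfolding boundary_ok_def by blast
  \<comment> \<open>Taking the image at the grade of \<open>g\<close> recovers the facet, so
    distinct facets never share a representative and no entries cancel.\<close>
  have inj: "inj_on \<phi> (facets (snd g))" using \<phi>(1) by (metis inj_onI)
  have sub: "\<phi> ` facets (snd g) \<subseteq> generators P K" using \<phi>(1) gens_uptoD(1) by blast
  have "(\<Sum>k\<in>generators P K. f k g * h (Gen k)) = (\<Sum>k\<in>\<phi> ` facets (snd g). h (Gen k))"
    using finite_generators sub
    by (intro sum.mono_neutral_cong_right) (auto simp: \<phi>(2))
  also have "\<dots> = (\<Sum>\<tau>\<in>facets (snd g). h (Gen (\<phi> \<tau>)))"
    using inj by (simp add: sum.reindex)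
  also have "\<dots> = (\<Sum>\<tau>\<in>facets (snd g). if inj_on (vmap K ?z x) \<tau> then H (vmap K ?z x ` \<tau>) else 0)"
  proof (rule sum.cong[OF refl])
    fix \<tau> assume "\<tau> \<in> facets (snd g)"
    note * = \<phi>(1)[OF this]
    then have "\<phi> \<tau> \<in> gens_upto x" using gens_upto_mono gD by blast
    then show "h (Gen (\<phi> \<tau>)) = (if inj_on (vmap K ?z x) \<tau> then H (vmap K ?z x ` \<tau>) else 0)"
      using H * image_at_comp[of "\<phi> \<tau>" ?z x] alive_comp[of "\<phi> \<tau>" ?z x] gD x by simp
  qed
  also have "\<dots> = (if alive x g then (\<Sum>\<tau>\<in>facets (image_at x g). H \<tau>) else 0)"
    unfolding alive_def image_at_def by (rule boundary_image[OF finite_gen[OF g]])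
  finally show ?thesis .
qed

lemma represented_values:
  fixes h :: "('p, 'v) node \<Rightarrow> bit"
  assumes ok: "grade_ok s x"
    and h: "\<And>m n. (m, n) \<in> connected_in (forest s x) \<Longrightarrow> h m = h n" "h Omega = 0"
  shows "\<exists>H. \<forall>k\<in>gens_upto x. h (Gen k) = (if alive x k then H (image_at x k) else 0)"
proof -
  define H where "H \<sigma> = h (Gen (THE g. (\<sigma>, g) \<in> act s x))" for \<sigma>
  have "h (Gen k) = (if alive x k then H (image_at x k) else 0)" if "k \<in> gens_upto x" for k
  proof -
    have r: "represents x (act s x) (forest s x) k" using ok that by (simp add: grade_ok_def)
    show ?thesis
    proof (cases "alive x k")
      case True
      then obtain g' where g': "(image_at x k, g') \<in> act s x" "(Gen k, Gen g') \<in> connected_in (forest s x)"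
        using r by (auto simp: represents_def)
      then have "(THE g. (image_at x k, g) \<in> act s x) = g'"
        using ok unfolding grade_ok_def by blast
      then show ?thesis using True g' h by (simp add: H_def)
    next
      case False
      then show ?thesis using r h by (auto simp: represents_def)
    qed
  qed
  then show ?thesis by blast
qed

text \<open>Moves the left factor of a product to the test function, where it acts by its
  transpose.\<close>

lemma mat_mult_pairing:
  fixes N :: "('a, 'b) mat"
  assumes "finite S" "finite J"
  shows "(\<Sum>g\<in>S. mat_mult J M N g r * q g) = (\<Sum>k\<in>J. N k r * (\<Sum>g\<in>S. M g k * q g))"
  unfolding mat_mult_def sum_distrib_right sum_distrib_left
  by (subst sum.swap) (simp add: mult_ac)

lemma balanced_relation:
  assumes ok: "grade_ok s (fst r)" and r: "relation_ok (p1 s) r" "fst r \<in> P"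
    and bd: "\<And>g. g \<in> gens_upto (fst r) \<Longrightarrow> boundary_ok (f0 s) g"
  shows "balanced (forest s (fst r)) (\<lambda>g. mat_mult (generators P K) (f0 s) (p1 s) g r)"
  unfolding balanced_def
proof (intro allI impI)
  fix h :: "('p, 'v) node \<Rightarrow> bit"
  let ?x = "fst r" and ?S = "generators P K"
  assume h: "\<forall>m n. (m, n) \<in> connected_in (forest s ?x) \<longrightarrow> h m = h n" "h Omega = 0"
  obtain H where H: "\<And>k. k \<in> gens_upto ?x \<Longrightarrow> h (Gen k) = (if alive ?x k then H (image_at ?x k) else 0)"
    using represented_values[OF ok, of h] h by blast
  \<comment> \<open>\<open>B\<close> is the coboundary of \<open>h\<close>. It vanishes on
    degenerate generators and depends only on the image of the others, so both kinds of relations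
    pair to zero with it.\<close>
  define B where "B k = (\<Sum>g\<in>?S. f0 s g k * h (Gen g))" for k
  have B: "B k = (if alive ?x k then (\<Sum>\<tau>\<in>facets (image_at ?x k). H \<tau>) else 0)" if "k \<in> gens_upto ?x" for k
    unfolding B_def using boundary_pairing[OF r(2) that bd[OF that] H] .
  have "(\<Sum>g\<in>?S. mat_mult ?S (f0 s) (p1 s) g r * h (Gen g)) = (\<Sum>k\<in>?S. p1 s k r * B k)"
    unfolding B_def by (rule mat_mult_pairing[OF finite_generators finite_generators])
  also have "\<dots> = 0"
    using r(1) unfolding relation_ok_def
  proof (elim disjE bexE conjE)
    fix g assume g: "g \<in> gens_upto ?x" "\<not> alive ?x g" "\<forall>h. p1 s h r = of_bool (h = g)"
    then show ?thesis using B by (intro sum.neutral ballI) (auto split: if_splits)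
  next
    fix g g'
    assume g: "g \<in> gens_upto ?x" "g' \<in> gens_upto ?x" "g \<noteq> g'" "alive ?x g" "alive ?x g'"
      "image_at ?x g = image_at ?x g'" "\<forall>h. p1 s h r = of_bool (h = g \<or> h = g')"
    have "(\<Sum>k\<in>?S. p1 s k r * B k) = (\<Sum>k\<in>{g, g'}. B k)"
      using finite_generators g gens_uptoD(1)
      by (intro sum.mono_neutral_cong_right) auto
    also have "\<dots> = 0" using g B by simp
    finally show ?thesis .
  qed
  finally show "(\<Sum>g\<in>?S. mat_mult ?S (f0 s) (p1 s) g r * h (Gen g)) = 0" .
qed

lemma balanced_boundary:
  assumes ok: "grade_ok s (fst g)" and g: "g \<in> generators P K"
    and bd: "\<And>k. k \<in> gens_upto (fst g) \<Longrightarrow> boundary_ok (f0 s) k"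
  shows "balanced (forest s (fst g)) (\<lambda>h. mat_mult (generators P K) (f0 s) (f0 s) h g)"
  unfolding balanced_def
proof (intro allI impI)
  fix h :: "('p, 'v) node \<Rightarrow> bit"
  let ?x = "fst g" and ?S = "generators P K"
  assume h: "\<forall>m n. (m, n) \<in> connected_in (forest s ?x) \<longrightarrow> h m = h n" "h Omega = 0"
  obtain H where H: "\<And>k. k \<in> gens_upto ?x \<Longrightarrow> h (Gen k) = (if alive ?x k then H (image_at ?x k) else 0)"
    using represented_values[OF ok, of h] h by blast
  note gD = generatorsD[OF g]
  obtain \<phi> where \<phi>: "\<And>\<tau>. \<tau> \<in> facets (snd g) \<Longrightarrow>
      \<phi> \<tau> \<in> gens_upto ?x \<and> alive ?x (\<phi> \<tau>) \<and> image_at ?x (\<phi> \<tau>) = \<tau>"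
    "\<And>h. f0 s h g = of_bool (h \<in> \<phi> ` facets (snd g))"
    using bd[OF gD(1)] unfolding boundary_ok_def by blast
  define B where "B k = (\<Sum>g\<in>?S. f0 s g k * h (Gen g))" for k
  have B: "B k = (if alive ?x k then (\<Sum>\<tau>\<in>facets (image_at ?x k). H \<tau>) else 0)" if "k \<in> gens_upto ?x" for k
    unfolding B_def using boundary_pairing[OF gD(2) that bd[OF that] H] .
  have inj: "inj_on \<phi> (facets (snd g))" using \<phi>(1) by (metis inj_onI)
  have sub: "\<phi> ` facets (snd g) \<subseteq> ?S" using \<phi>(1) gens_uptoD(1) by blast
  have "(\<Sum>k\<in>?S. mat_mult ?S (f0 s) (f0 s) k g * h (Gen k)) = (\<Sum>k\<in>?S. f0 s k g * B k)"
    unfolding B_def by (rule mat_mult_pairing[OF finite_generators finite_generators])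
  also have "\<dots> = (\<Sum>k\<in>\<phi> ` facets (snd g). B k)"
    using finite_generators sub
    by (intro sum.mono_neutral_cong_right) (auto simp: \<phi>(2))
  also have "\<dots> = (\<Sum>\<tau>\<in>facets (snd g). B (\<phi> \<tau>))"
    using inj by (simp add: sum.reindex)
  \<comment> \<open>At the grade of \<open>g\<close> the representative of a facet has that facet as
    its image, which turns the sum into a double boundary.\<close>
  also have "\<dots> = (\<Sum>\<tau>\<in>facets (snd g). \<Sum>\<kappa>\<in>facets \<tau>. H \<kappa>)"
    by (rule sum.cong) (use B \<phi>(1) in auto)
  also have "\<dots> = 0" by (rule boundary_boundary[OF finite_gen[OF gD(1)]])
  finally show "(\<Sum>k\<in>?S. mat_mult ?S (f0 s) (f0 s) k g * h (Gen k)) = 0" .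
qed

lemma lift_column_vertex_sums:
  assumes G: "graph_ok R p x F" and bal: "balanced F c"
    and lc: "lift_column P K F c d" and g: "Gen g \<in> verts F"
  shows "(\<Sum>e\<in>incident F (Gen g). d (fst e)) = c g"
proof -
  let ?S = "generators P K"
  define b where "b n = (case n of Omega \<Rightarrow> \<Sum>g\<in>?S. c g | Gen g \<Rightarrow> c g)" for n
  have wf: "wf_mgraph F" and vF: "Omega \<in> verts F" "verts F \<subseteq> insert Omega (Gen ` ?S)"
    using G gens_uptoD(1) by (auto simp: graph_ok_def)
  let ?C = "component F (Gen g)"
  have "\<forall>C\<in>components F. \<exists>x. tree_solve C b x \<and> (\<forall>e\<in>edges C. d (fst e) = x e)"
    using lc by (simp add: lift_column_def Let_def b_def[abs_def])
  moreover have "?C \<in> components F" using g by (simp add: components_def)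
  ultimately obtain x where x: "tree_solve ?C b x" "\<And>e. e \<in> edges ?C \<Longrightarrow> d (fst e) = x e"
    by meson
  note sub = verts_component_subset[OF wf g]
  have "(\<Sum>n\<in>verts ?C. b n) = 0"
  proof -
    define q where "q n = (of_bool (n \<in> verts ?C) :: bit)" for n
    have fin: "finite (verts ?C)" using wf_component[OF wf g] by (simp add: wf_mgraph_def)
    have qc: "q m = q n" if "(m, n) \<in> connected_in F" for m n
    proof -
      have "(Gen g, m) \<in> connected_in F \<longleftrightarrow> (Gen g, n) \<in> connected_in F"
        using connected_in_trans[OF _ that] connected_in_trans[OF _ connected_in_sym[OF that]] by blast
      then show ?thesis by (simp add: q_def verts_component)
    qed
    have "(\<Sum>n\<in>verts ?C. b n) = (\<Sum>n\<in>insert Omega (Gen ` ?S). q n * b n)"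
      using sub vF finite_generators by (intro sum.mono_neutral_cong_left) (auto simp: q_def)
    also have "\<dots> = q Omega * (\<Sum>k\<in>?S. c k) + (\<Sum>k\<in>?S. q (Gen k) * c k)"
      using finite_generators by (subst sum.insert) (auto simp: b_def sum.reindex inj_on_def)
    \<comment> \<open>The entry at \<open>Omega\<close> is the sum of all the others. It replaces
      the indicator \<open>q\<close> of the tree by \<open>q + q Omega\<close>, which vanishes at
      \<open>Omega\<close> as a test function must.\<close>
    also have "\<dots> = (\<Sum>k\<in>?S. c k * (q (Gen k) + q Omega))"
      by (simp add: algebra_simps sum.distrib sum_distrib_left)
    also have "\<dots> = 0"
      using bal[unfolded balanced_def, rule_format, of "\<lambda>n. q n + q Omega"] qc by auto
    finally show ?thesis .
  qed
  then have "(\<Sum>e\<in>incident ?C (Gen g). x e) = b (Gen g)"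
    using tree_solve_correct[OF x(1) wf_component[OF wf g] connected_component]
    by (simp add: verts_component)
  moreover have "(\<Sum>e\<in>incident ?C (Gen g). x e) = (\<Sum>e\<in>incident ?C (Gen g). d (fst e))"
    by (rule sum.cong) (auto simp: incident_def x(2))
  ultimately show ?thesis by (simp add: incident_component[OF wf] b_def)
qed

text \<open>Restricted to labels of forest edges, the row of \<open>g\<close> marks the edges at
  \<open>g\<close>, so the product is the vertex sum that TreeSolve has arranged. For
  \<open>g\<close> outside the forest both sides are zero.\<close>

lemma lift_column_product:
  assumes G: "graph_ok R p x F" and bal: "balanced F c" and supp: "\<And>g. c g \<noteq> 0 \<Longrightarrow> Gen g \<in> verts F"
    and lc: "lift_column P K F c d" and fin: "finite R"
  shows "(\<Sum>r\<in>R. p g r * d r) = c g"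
proof -
  have d0: "d r = 0" if "r \<notin> fst ` edges F" for r
    using lc that by (auto simp: lift_column_def Let_def)
  have E: "fst e \<in> R" "p g (fst e) = of_bool (Gen g \<in> snd e)" if "e \<in> edges F" for e
    using G that by (auto simp: graph_ok_def)
  have finE: "finite (edges F)" using G by (simp add: graph_ok_def wf_mgraph_def)
  have "(\<Sum>r\<in>R. p g r * d r) = (\<Sum>r\<in>fst ` edges F. p g r * d r)"
    using fin E(1) d0 by (intro sum.mono_neutral_right) auto
  also have "\<dots> = (\<Sum>e\<in>edges F. p g (fst e) * d (fst e))"
    using inj_on_labels[OF G] by (simp add: sum.reindex)
  also have "\<dots> = (\<Sum>e\<in>incident F (Gen g). d (fst e))"
    using finE by (intro sum.mono_neutral_cong_right) (auto simp: incident_def E(2))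
  also have "\<dots> = c g"
  proof (cases "Gen g \<in> verts F")
    case True
    then show ?thesis by (rule lift_column_vertex_sums[OF G bal lc])
  next
    case False
    then have "incident F (Gen g) = {}"
      using G by (auto simp: incident_def graph_ok_def wf_mgraph_def)
    then show ?thesis using False supp by (metis sum.empty)
  qed
  finally show ?thesis .
qed

text \<open>The solution on a tree is unique, and discarding the edges of other dimensions from it leaves a
  solution, since the trees of generators of different dimensions only meet at \<open>Omega\<close>.\<close>

lemma lift_column_dim:
  assumes G: "graph_ok R p x F" and ac: "acyclic_mgraph F" and bal: "balanced F c"
    and supp: "\<And>g. c g \<noteq> 0 \<Longrightarrow> Gen g \<in> verts F \<and> sdim (snd g) = m"
    and lc: "lift_column P K F c d" and rel: "\<And>r. r \<in> R \<Longrightarrow> relation_ok p r" and d: "d r \<noteq> 0"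
  shows "r \<in> R" "fst r \<le> x" "\<exists>g. p g r \<noteq> 0 \<and> sdim (snd g) = m"
proof -
  have "r \<in> fst ` edges F" using lc d by (auto simp: lift_column_def Let_def)
  then obtain e where e: "e \<in> edges F" "r = fst e" by auto
  then show "r \<in> R" "fst r \<le> x" using G by (auto simp: graph_ok_def)
  have E: "p g (fst e) = of_bool (Gen g \<in> snd e)" "fst e \<in> R" if "e \<in> edges F" for e g
    using G that by (auto simp: graph_ok_def)
  have wf: "wf_mgraph F" and O: "Omega \<in> verts F" using G by (auto simp: graph_ok_def)
  \<comment> \<open>The discarded part of the solution. Its vertex sums vanish everywhere except
    perhaps at \<open>Omega\<close>, so it is zero.\<close>
  define y where "y e = (if \<exists>g. Gen g \<in> snd e \<and> sdim (snd g) = m then 0 else d (fst e))"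
    for e :: "(('p, 'v) node, 'p rid) edge"
  have "(\<Sum>e\<in>incident F v. y e) = 0" if v: "v \<in> verts F" "v \<noteq> Omega" for v
  proof -
    obtain g where g: "v = Gen g" using v(2) by (cases v) auto
    show ?thesis
    proof (cases "sdim (snd g) = m")
      case True
      then show ?thesis by (intro sum.neutral) (auto simp: y_def incident_def g)
    next
      case False
      have "y e = d (fst e)" if "e \<in> incident F v" for e
      proof -
        \<comment> \<open>All generators on an edge have the same dimension, so \<open>y\<close>
          either keeps or kills all edges at \<open>g\<close> together.\<close>
        have "sdim (snd k) = sdim (snd g)" if "Gen k \<in> snd e" for k
          using that \<open>e \<in> incident F v\<close> E[of e] relation_ok_dim[OF rel, of "fst e" k g]
          by (auto simp: incident_def g)
        then show ?thesis using False by (auto simp: y_def)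
      qed
      then have "(\<Sum>e\<in>incident F v. y e) = (\<Sum>e\<in>incident F v. d (fst e))" by simp
      also have "\<dots> = c g"
        unfolding g by (rule lift_column_vertex_sums[OF G bal lc]) (use v g in simp)
      also have "\<dots> = 0" using supp False by metis
      finally show ?thesis .
    qed
  qed
  from acyclic_vertex_sums_zero[OF wf ac O this e(1)] have "y e = 0" .
  then have "\<exists>g. Gen g \<in> snd e \<and> sdim (snd g) = m" using d e(2) by (auto simp: y_def split: if_splits)
  then show "\<exists>g. p g r \<noteq> 0 \<and> sdim (snd g) = m" using E[OF e(1)] e(2) by auto
qed

lemma mat_mult_nonzero:
  assumes "mat_mult J M N i k \<noteq> 0"
  shows "\<exists>j\<in>J. M i j \<noteq> 0 \<and> N j k \<noteq> 0"
proof (rule ccontr)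
  assume "\<not> ?thesis"
  then have "M i j * N j k = 0" if "j \<in> J" for j using that by fastforce
  then have "mat_mult J M N i k = 0" unfolding mat_mult_def by (intro sum.neutral) blast
  then show False using assms by blast
qed

text \<open>Passes between the matrices for all degrees at once and their parts in a single degree:
  the selected columns of \<open>N\<close> only use rows in \<open>J\<close>.\<close>

lemma columns_mat_mult:
  assumes "finite J'" "J \<subseteq> J'" "\<And>j k. j \<in> J' \<Longrightarrow> k \<in> I \<Longrightarrow> N j k \<noteq> 0 \<Longrightarrow> j \<in> J"
  shows "mat_mult J (columns J M) (columns I N) = columns I (mat_mult J' M N)"
proof (intro ext)
  fix i k
  show "mat_mult J (columns J M) (columns I N) i k = columns I (mat_mult J' M N) i k"
  proof (cases "k \<in> I")
    case True
    have "(\<Sum>j\<in>J. M i j * N j k) = (\<Sum>j\<in>J'. M i j * N j k)"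
    proof (rule sum.mono_neutral_left)
      show "\<forall>j\<in>J' - J. M i j * N j k = 0" using assms(3) True by (metis DiffE mult_zero_right)
    qed (use assms in auto)
    then show ?thesis using True by (simp add: mat_mult_def columns_def)
  qed (simp add: mat_mult_def columns_def)
qed

lemma lift_correct:
  assumes pr: "processed P s"
  defines "G \<equiv> generators_of_dim P K" and "R \<equiv> relations_of_dim s"
  shows "proj_hom (R l) (G l) (columns (R l) (p1 s))"
    and "proj_hom (G l) (G (l - 1)) (columns (G l) (f0 s))"
    and "proj_hom (R l) (R (l - 1)) (columns (R l) (f1 s))"
    and "proj_hom (G (l + 1)) (R (l - 1)) (columns (G (l + 1)) (theta s))"
    and "mat_mult (R (l - 1)) (columns (R (l - 1)) (p1 s)) (columns (R l) (f1 s)) =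
      mat_mult (G l) (columns (G l) (f0 s)) (columns (R l) (p1 s))"
    and "mat_mult (R (l - 1)) (columns (R (l - 1)) (p1 s)) (columns (G (l + 1)) (theta s)) =
      mat_mult (G l) (columns (G l) (f0 s)) (columns (G (l + 1)) (f0 s))"
proof -
  let ?S = "generators P K"
  have rel: "fst r \<in> P" "relation_ok (p1 s) r" if "r \<in> rels s" for r
    using pr that by (auto simp: processed_def rels_ok_def)
  have finR: "finite (rels s)" using pr by (simp add: processed_def rels_ok_def)
  have bd: "boundary_ok (f0 s) g" if "g \<in> ?S" for g
    using pr generatorsD[OF that] that by (auto simp: processed_def)
  have grade: "grade_ok s x" "lifted s x" if "x \<in> P" for x
    using pr that by (auto simp: processed_def)
  then have forest: "graph_ok (rels s) (p1 s) x (forest s x)" "acyclic_mgraph (forest s x)"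
    "\<And>g. g \<in> gens_upto x \<Longrightarrow> Gen g \<in> verts (forest s x)" if "x \<in> P" for x
    using that unfolding grade_ok_def by blast+
  have R: "r \<in> R k \<longleftrightarrow> r \<in> rels s \<and> (\<exists>g. p1 s g r \<noteq> 0 \<and> sdim (snd g) = k)" for r k
    by (simp add: R_def relations_of_dim_def)
  have Gk: "g \<in> G k \<longleftrightarrow> g \<in> ?S \<and> sdim (snd g) = k" for g k
    by (simp add: G_def generators_of_dim_def)
  have fin: "finite (R k)" "finite (G k)" for k
    using finR finite_generators by (auto simp: R_def relations_of_dim_def G_def generators_of_dim_def)
  have p1: "g \<in> G k \<and> fst g \<le> fst r" if g: "p1 s g r \<noteq> 0" and r: "r \<in> R k" for g r k
  proof -
    obtain h where h: "r \<in> rels s" "p1 s h r \<noteq> 0" "sdim (snd h) = k" using r unfolding R by blast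
    then have "g \<in> gens_upto (fst r)" "sdim (snd g) = k"
      using relation_ok_support[OF rel(2) g] relation_ok_dim[OF rel(2) g h(2)] by simp_all
    then show ?thesis unfolding Gk gens_upto_def by blast
  qed
  have f0: "h \<in> G (k - 1) \<and> fst h \<le> fst g" if "f0 s h g \<noteq> 0" "g \<in> G k" for h g k
  proof -
    have g: "g \<in> ?S" "sdim (snd g) = k" using that(2) by (simp_all add: Gk)
    show ?thesis
      using boundary_ok_support[OF bd[OF g(1)] that(1)] g(2) by (simp add: Gk gens_upto_def)
  qed
  have bd': "boundary_ok (f0 s) g" if "g \<in> gens_upto x" for g x
    using bd gens_uptoD(1)[OF that] .
  have c1: "balanced (forest s (fst r)) (\<lambda>g. mat_mult ?S (f0 s) (p1 s) g r)"
    "lift_column P K (forest s (fst r)) (\<lambda>g. mat_mult ?S (f0 s) (p1 s) g r) (\<lambda>r'. f1 s r' r)"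
    if r: "r \<in> rels s" for r
  proof -
    show "balanced (forest s (fst r)) (\<lambda>g. mat_mult ?S (f0 s) (p1 s) g r)"
      by (rule balanced_relation[OF grade(1)[OF rel(1)[OF r]] rel(2)[OF r] rel(1)[OF r] bd'])
  qed (use grade(2)[OF rel(1)[OF r]] r in \<open>simp add: lifted_def\<close>)
  have c1s: "Gen g \<in> verts (forest s (fst r)) \<and> sdim (snd g) = k - 1"
    if nz: "mat_mult ?S (f0 s) (p1 s) g r \<noteq> 0" and r: "r \<in> R k" for g r k
  proof -
    obtain j where "j \<in> ?S" "f0 s g j \<noteq> 0" "p1 s j r \<noteq> 0" using mat_mult_nonzero[OF nz] by blast
    then have "j \<in> G k" "fst j \<le> fst r" "g \<in> G (k - 1)" "fst g \<le> fst j"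
      using p1[of j r k] f0[of g j k] r by auto
    \<comment> \<open>Grades do not increase along either factor, so the product only reaches
      generators that are vertices of the forest at the grade of \<open>r\<close>.\<close>
    then have "g \<in> gens_upto (fst r)" "sdim (snd g) = k - 1" by (auto simp: Gk gens_upto_def)
    moreover have "fst r \<in> P" using rel(1) r by (simp add: R)
    ultimately show ?thesis using forest(3) by blast
  qed
  have c2: "balanced (forest s (fst g)) (\<lambda>h. mat_mult ?S (f0 s) (f0 s) h g)"
    "lift_column P K (forest s (fst g)) (\<lambda>h. mat_mult ?S (f0 s) (f0 s) h g) (\<lambda>r'. theta s r' g)"
    if g: "g \<in> ?S" for g
  proof -
    show "balanced (forest s (fst g)) (\<lambda>h. mat_mult ?S (f0 s) (f0 s) h g)"
      by (rule balanced_boundary[OF grade(1)[OF generatorsD(2)[OF g]] g bd'])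
  qed (use grade(2)[OF generatorsD(2)[OF g]] g in \<open>simp add: lifted_def\<close>)
  have c2s: "Gen h \<in> verts (forest s (fst g)) \<and> sdim (snd h) = k - 2"
    if nz: "mat_mult ?S (f0 s) (f0 s) h g \<noteq> 0" and g: "g \<in> G k" for g h k
  proof -
    obtain j where "j \<in> ?S" "f0 s h j \<noteq> 0" "f0 s j g \<noteq> 0" using mat_mult_nonzero[OF nz] by blast
    then have "fst j \<le> fst g" "h \<in> G (k - 1 - 1)" "fst h \<le> fst j"
      using f0[of j g k] f0[of h j "k - 1"] g by auto
    then have "h \<in> gens_upto (fst g)" "sdim (snd h) = k - 2" by (auto simp: Gk gens_upto_def)
    moreover have "fst g \<in> P" using generatorsD(2) g by (simp add: Gk)
    ultimately show ?thesis using forest(3) by blast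
  qed
  have f1: "r' \<in> R (k - 1) \<and> fst r' \<le> fst r" if "f1 s r' r \<noteq> 0" "r \<in> R k" for r' r k
  proof -
    have r: "r \<in> rels s" using that by (simp add: R)
    show ?thesis
      using lift_column_dim[where d = "\<lambda>r'. f1 s r' r", OF forest(1,2)[OF rel(1)[OF r]] c1(1)[OF r] c1s[OF _ that(2)] c1(2)[OF r] rel(2) that(1)]
      unfolding R by blast
  qed
  \<comment> \<open>Two boundaries lower the dimension by two, and a relation has the dimension of
    its generators. For \<open>k = l + 1\<close> this is degree \<open>l - 1\<close>.\<close>
  have th: "r' \<in> R (k - 2) \<and> fst r' \<le> fst g" if "theta s r' g \<noteq> 0" "g \<in> G k" for r' g k
  proof -
    have g: "g \<in> ?S" using that by (simp add: Gk)
    note gP = generatorsD(2)[OF g]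
    show ?thesis
      using lift_column_dim[where d = "\<lambda>r'. theta s r' g", OF forest(1,2)[OF gP] c2(1)[OF g] c2s[OF _ that(2)] c2(2)[OF g] rel(2) that(1)]
      unfolding R by blast
  qed
  show "proj_hom (R l) (G l) (columns (R l) (p1 s))"
    unfolding proj_hom_def columns_def using fin p1 by auto
  show "proj_hom (G l) (G (l - 1)) (columns (G l) (f0 s))"
    unfolding proj_hom_def columns_def using fin f0 by auto
  show "proj_hom (R l) (R (l - 1)) (columns (R l) (f1 s))"
    unfolding proj_hom_def columns_def using fin f1 by auto
  show "proj_hom (G (l + 1)) (R (l - 1)) (columns (G (l + 1)) (theta s))"
    unfolding proj_hom_def columns_def using fin th[of _ _ "l + 1"] by auto
  have sub: "R k \<subseteq> rels s" "G k \<subseteq> ?S" for k by (auto simp: R Gk)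
  have "mat_mult (R (l - 1)) (columns (R (l - 1)) (p1 s)) (columns (R l) (f1 s)) =
      columns (R l) (mat_mult (rels s) (p1 s) (f1 s))"
    by (rule columns_mat_mult[OF finR sub(1)]) (use f1 in blast)
  also have "\<dots> = columns (R l) (mat_mult ?S (f0 s) (p1 s))"
  proof (intro ext)
    fix g r
    have "mat_mult (rels s) (p1 s) (f1 s) g r = mat_mult ?S (f0 s) (p1 s) g r" if r: "r \<in> R l"
    proof -
      have r': "r \<in> rels s" using r by (simp add: R)
      show ?thesis
        unfolding mat_mult_def[of "rels s"]
        using lift_column_product[OF forest(1)[OF rel(1)[OF r']] c1(1)[OF r'] _ c1(2)[OF r'] finR]
          c1s[OF _ r] by blast
    qed
    then show "columns (R l) (mat_mult (rels s) (p1 s) (f1 s)) g r = columns (R l) (mat_mult ?S (f0 s) (p1 s)) g r"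
      by (simp add: columns_def)
  qed
  also have "\<dots> = mat_mult (G l) (columns (G l) (f0 s)) (columns (R l) (p1 s))"
    by (rule columns_mat_mult[OF finite_generators sub(2), symmetric]) (use p1 in blast)
  finally show "mat_mult (R (l - 1)) (columns (R (l - 1)) (p1 s)) (columns (R l) (f1 s)) =
      mat_mult (G l) (columns (G l) (f0 s)) (columns (R l) (p1 s))" .
  have "mat_mult (R (l - 1)) (columns (R (l - 1)) (p1 s)) (columns (G (l + 1)) (theta s)) =
      columns (G (l + 1)) (mat_mult (rels s) (p1 s) (theta s))"
    by (rule columns_mat_mult[OF finR sub(1)]) (use th[of _ _ "l + 1"] in auto)
  also have "\<dots> = columns (G (l + 1)) (mat_mult ?S (f0 s) (f0 s))"
  proof (intro ext)
    fix h g
    have "mat_mult (rels s) (p1 s) (theta s) h g = mat_mult ?S (f0 s) (f0 s) h g" if g: "g \<in> G (l + 1)"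
    proof -
      have g': "g \<in> ?S" using g by (simp add: Gk)
      show ?thesis
        unfolding mat_mult_def[of "rels s"]
        using lift_column_product[OF forest(1)[OF generatorsD(2)[OF g']] c2(1)[OF g'] _ c2(2)[OF g'] finR]
          c2s[OF _ g] by blast
    qed
    then show "columns (G (l + 1)) (mat_mult (rels s) (p1 s) (theta s)) h g =
        columns (G (l + 1)) (mat_mult ?S (f0 s) (f0 s)) h g"
      by (simp add: columns_def)
  qed
  also have "\<dots> = mat_mult (G l) (columns (G l) (f0 s)) (columns (G (l + 1)) (f0 s))"
    by (rule columns_mat_mult[OF finite_generators sub(2), symmetric]) (use f0[of _ _ "l + 1"] in auto)
  finally show "mat_mult (R (l - 1)) (columns (R (l - 1)) (p1 s)) (columns (G (l + 1)) (theta s)) =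
      mat_mult (G l) (columns (G l) (f0 s)) (columns (G (l + 1)) (f0 s))" .
qed

end

section \<open>Total correctness of nondeterministic routines\<close>

text \<open>Total correctness with demonic choice. The two conjuncts travel together because the
  next routine can proceed only from states that satisfy \<open>Q\<close>.\<close>

definition achieves :: "('s \<Rightarrow> 's \<Rightarrow> bool) \<Rightarrow> 's \<Rightarrow> ('s \<Rightarrow> bool) \<Rightarrow> bool" where
  "achieves R s Q \<longleftrightarrow> (\<exists>s'. R s s') \<and> (\<forall>s'. R s s' \<longrightarrow> Q s')"

lemma achievesI: "\<exists>s'. R s s' \<Longrightarrow> (\<And>s'. R s s' \<Longrightarrow> Q s') \<Longrightarrow> achieves R s Q"
  by (simp add: achieves_def)

lemma achieves_mono: "achieves R s Q \<Longrightarrow> (\<And>t. Q t \<Longrightarrow> Q' t) \<Longrightarrow> achieves R s Q'"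
  by (auto simp: achieves_def)

lemma achieves_OO:
  "achieves A s Q \<Longrightarrow> (\<And>t. Q t \<Longrightarrow> achieves B t Q') \<Longrightarrow> achieves (A OO B) s Q'"
  unfolding achieves_def by blast

text \<open>The invariant depends on the treated prefix and a step knows its position in the list.
  This is how the order by dimension and the linear extension enter.\<close>

lemma achieves_foreach_list:
  assumes "I [] s"
    and "\<And>ps a qs t. as = ps @ a # qs \<Longrightarrow> I ps t \<Longrightarrow> achieves (body a) t (I (ps @ [a]))"
  shows "achieves (foreach_list body as) s (I as)"
proof -
  have "achieves (foreach_list body qs) t (I as)" if "as = ps @ qs" "I ps t" for ps qs t
    using that
  proof (induction qs arbitrary: ps t)
    case (Cons a qs)
    have 1: "achieves (body a) t (I (ps @ [a]))" using assms(2) Cons.prems by blast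
    have 2: "achieves (foreach_list body qs) t' (I as)" if "I (ps @ [a]) t'" for t'
      using Cons.IH[of "ps @ [a]" t'] Cons.prems that by simp
    show ?case using 1 2 unfolding achieves_def foreach_list.simps by blast
  qed (simp add: achieves_def)
  from this[of "[]" as s] show ?thesis using assms(1) by simp
qed

text \<open>The order of iteration is free here, so the invariant may depend only on the set of
  treated elements.\<close>

lemma achieves_foreach:
  assumes "finite A" "I {} s"
    and "\<And>B a t. B \<subseteq> A \<Longrightarrow> a \<in> A \<Longrightarrow> I B t \<Longrightarrow> achieves (body a) t (I (insert a B))"
  shows "achieves (foreach A body) s (I A)"
proof -
  have *: "achieves (foreach_list body as) s (I A)" if as: "set as = A" for as
  proof -
    have "achieves (foreach_list body as) s (I (set as))"
    proof (rule achieves_foreach_list)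
      fix ps a qs t
      assume "as = ps @ a # qs" "I (set ps) t"
      then show "achieves (body a) t (I (set (ps @ [a])))" using assms(3)[of "set ps" a t] as by auto
    qed (simp add: assms(2))
    then show ?thesis by (simp add: as)
  qed
  obtain as where "distinct as" "set as = A" using finite_distinct_list[OF assms(1)] by blast
  then show ?thesis using * unfolding achieves_def foreach_def by blast
qed

section \<open>Existence of lifts\<close>

context finite_poset_tower
begin

text \<open>Choose a TreeSolve output on each tree and glue. The result is well defined because a
  label names one edge of the forest and an edge lies in one tree.\<close>

lemma lift_column_exists:
  assumes G: "graph_ok R p x F" and ac: "acyclic_mgraph F"
  shows "\<exists>d. lift_column P K F c d"
proof -
  define b where "b n = (case n of Omega \<Rightarrow> \<Sum>g\<in>generators P K. c g | Gen g \<Rightarrow> c g)" for n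
  have wf: "wf_mgraph F" using G by (simp add: graph_ok_def)
  have "\<forall>C\<in>components F. \<exists>x. tree_solve C b x"
    unfolding components_def using tree_solve_exists[OF wf_component[OF wf] acyclic_component[OF ac]] by blast
  then obtain X where X: "\<And>C. C \<in> components F \<Longrightarrow> tree_solve C b (X C)" by metis
  define val where "val e = X (THE C. C \<in> components F \<and> e \<in> edges C) e" for e
  define d where "d r = (if r \<in> fst ` edges F then val (THE e. e \<in> edges F \<and> fst e = r) else 0)" for r
  have "d (fst e) = X C e" if C: "C \<in> components F" "e \<in> edges C" for C e
  proof -
    have e: "e \<in> edges F" using C by (auto simp: components_def edges_component)
    have "(THE e'. e' \<in> edges F \<and> fst e' = fst e) = e"
      using e inj_on_labels[OF G] by (intro the_equality) (auto dest: inj_onD)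
    moreover have "(THE C. C \<in> components F \<and> e \<in> edges C) = C"
      using components_edge_unique[OF wf] C by (intro the_equality) blast+
    ultimately show ?thesis using e by (simp add: d_def val_def)
  qed
  then have "lift_column P K F c d"
    unfolding lift_column_def Let_def b_def[abs_def, symmetric]
    using X by (metis d_def)
  then show ?thesis by (rule exI[of _ d])
qed

section \<open>Processing a grade\<close>

lemma relation_ok_cong: "(\<And>g. p g r = p' g r) \<Longrightarrow> relation_ok p r \<longleftrightarrow> relation_ok p' r"
  by (simp add: relation_ok_def)

lemma boundary_ok_cong: "(\<And>h. f h g = f' h g) \<Longrightarrow> boundary_ok f g \<longleftrightarrow> boundary_ok f' g"
  by (simp add: boundary_ok_def)

lemma graph_ok_mono:
  assumes "graph_ok R p x G" "R \<subseteq> R'" "\<And>r g. r \<in> R \<Longrightarrow> p' g r = p g r"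
  shows "graph_ok R' p' x G"
  using assms unfolding graph_ok_def by (metis subsetD)

lemma graph_ok_edges_subset:
  assumes "graph_ok R p x G" "verts F = verts G" "edges F \<subseteq> edges G"
  shows "graph_ok R p x F"
proof -
  have "finite (edges F)" using assms by (auto simp: graph_ok_def wf_mgraph_def intro: finite_subset)
  then show ?thesis using assms unfolding graph_ok_def wf_mgraph_def by (simp add: subset_iff) blast
qed

lemma represents_mono:
  assumes "represents x A G g" "A \<subseteq> A'" "edges G \<subseteq> edges G'"
  shows "represents x A' G' g"
  using assms connected_in_mono[OF assms(3)] unfolding represents_def by (auto split: if_splits)

lemma act_okD:
  assumes "act_ok x A" "(\<sigma>, g) \<in> A"
  shows "g \<in> gens_upto x" "alive x g" "image_at x g = \<sigma>"
  using assms by (auto simp: act_ok_def)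

lemma act_ok_finite:
  assumes "act_ok x A"
  shows "finite A"
proof (rule finite_subset)
  show "A \<subseteq> (\<lambda>g. (image_at x g, g)) ` gens_upto x"
    using act_okD[OF assms] by (auto simp: image_iff)
qed (simp add: finite_gens_upto)

text \<open>Graphs do not occur because later grades read only the forests of earlier ones. Columns
  of \<open>p1\<close> are protected for existing relations, since a fresh relation brings a new
  column.\<close>

definition frame :: "'p \<Rightarrow> ('p, 'v) state \<Rightarrow> ('p, 'v) state \<Rightarrow> bool" where
  "frame x s s' \<longleftrightarrow>
     (\<forall>y. y \<noteq> x \<longrightarrow> act s' y = act s y \<and> forest s' y = forest s y) \<and>
     rels s \<subseteq> rels s' \<and> (\<forall>r\<in>rels s' - rels s. fst r = x) \<and> (\<forall>r\<in>rels s. \<forall>g. p1 s' g r = p1 s g r) \<and>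
     (\<forall>g. fst g \<noteq> x \<longrightarrow> (\<forall>h. f0 s' h g = f0 s h g) \<and> (\<forall>r. theta s' r g = theta s r g)) \<and>
     (\<forall>r. fst r \<noteq> x \<longrightarrow> (\<forall>r'. f1 s' r' r = f1 s r' r))"

lemma frame_trans:
  assumes "frame x s t" "frame x t u"
  shows "frame x s u"
  using assms unfolding frame_def by (auto simp: subset_iff)

text \<open>The invariant shared by Collapse and Generator while grade \<open>x\<close> is under
  construction. The last two clauses supply the endpoints of every edge that may be added.\<close>

definition working :: "'p set \<Rightarrow> 'p \<Rightarrow> ('p, 'v) state \<Rightarrow> ('p, 'v) state \<Rightarrow> bool" where
  "working D x s t \<longleftrightarrow> frame x s t \<and> rels_ok (insert x D) t \<and> graph_ok (rels t) (p1 t) x (graph t x) \<and>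
     act_ok x (act t x) \<and> (\<forall>g\<in>gens_upto x. fst g \<noteq> x \<longrightarrow> Gen g \<in> verts (graph t x)) \<and>
     (\<forall>\<sigma> g. (\<sigma>, g) \<in> act t x \<longrightarrow> Gen g \<in> verts (graph t x))"

text \<open>Assumption \<open>ok\<close> uses a matrix all of whose columns equal the new one,
  because the name of the fresh relation is not known in advance.\<close>

lemma achieves_try_relation:
  assumes w: "working D x s t" and uv: "u \<noteq> v" "u \<in> verts (graph t x)" "v \<in> verts (graph t x)"
    and ok: "\<And>r. fst r = x \<Longrightarrow> relation_ok (\<lambda>g r. of_bool (Gen g \<in> {u, v})) r"
  shows "achieves (try_relation x u v) t (\<lambda>t'. working D x s t' \<and> act t' = act t \<and> f0 t' = f0 t \<and>
    verts (graph t' x) = verts (graph t x) \<and> edges (graph t x) \<subseteq> edges (graph t' x) \<and>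
    (u, v) \<in> connected_in (graph t' x))"
proof (rule achievesI)
  have "finite (rels t)" using w by (simp add: working_def rels_ok_def)
  then obtain n where "n \<notin> snd ` rels t" using ex_new_if_finite[OF infinite_UNIV_nat] by blast
  then have "(x, n) \<notin> rels t" by force
  then show "\<exists>t'. try_relation x u v t t'" unfolding try_relation_def by (metis fst_conv)
next
  fix t'
  assume "try_relation x u v t t'"
  then obtain r where r: "fst r = x" "r \<notin> rels t" and t':
    "t' = (if creates_cycle (graph t x) (r, {u, v}) then t
           else t\<lparr>graph := (graph t)(x := add_edge (r, {u, v}) (graph t x)),
                  rels := insert r (rels t),
                  p1 := set_column (p1 t) r (\<lambda>g. of_bool (Gen g \<in> {u, v}))\<rparr>)"
    unfolding try_relation_def by blast
  show "working D x s t' \<and> act t' = act t \<and> f0 t' = f0 t \<and> verts (graph t' x) = verts (graph t x) \<and>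
    edges (graph t x) \<subseteq> edges (graph t' x) \<and> (u, v) \<in> connected_in (graph t' x)"
  proof (cases "creates_cycle (graph t x) (r, {u, v})")
    case True
    then show ?thesis using t' w creates_cycle_connected by fastforce
  next
    case False
    let ?G = "add_edge (r, {u, v}) (graph t x)" and ?p = "set_column (p1 t) r (\<lambda>g. of_bool (Gen g \<in> {u, v}))"
    have t'eq: "t' = t\<lparr>graph := (graph t)(x := ?G), rels := insert r (rels t), p1 := ?p\<rparr>"
      using False t' by simp
    have p: "?p g r' = p1 t g r'" if "r' \<in> rels t" for g r'
      using that r by (auto simp: set_column_def)
    have pr: "?p g r = of_bool (Gen g \<in> {u, v})" for g by (simp add: set_column_def)
    have Gok: "graph_ok (rels t) (p1 t) x (graph t x)" using w by (simp add: working_def)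
    have "graph_ok (insert r (rels t)) ?p x (graph t x)"
      by (rule graph_ok_mono[OF Gok _ p]) auto
    then have "graph_ok (insert r (rels t)) ?p x ?G"
      using uv r pr unfolding graph_ok_def wf_mgraph_def by (simp add: add_edge_def card_insert_if)
    moreover have "rels_ok (insert x D) t'"
    proof -
      have "relation_ok (\<lambda>g r. of_bool (Gen g \<in> {u, v})) r \<longleftrightarrow> relation_ok ?p r"
        by (rule relation_ok_cong) (simp only: pr)
      then have "relation_ok ?p r" using ok[OF r(1)] by blast
      moreover have "relation_ok ?p r'" if "r' \<in> rels t" for r'
      proof -
        have "relation_ok ?p r' \<longleftrightarrow> relation_ok (p1 t) r'" by (rule relation_ok_cong) (rule p[OF that])
        then show ?thesis using that w by (simp add: working_def rels_ok_def)
      qed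
      ultimately show ?thesis using w r by (auto simp: t'eq working_def rels_ok_def)
    qed
    moreover have "frame x t t'" using r p by (auto simp: frame_def t'eq)
    then have "frame x s t'" using w frame_trans by (auto simp: working_def)
    ultimately have "working D x s t'"
      using w unfolding working_def by (simp add: t'eq add_edge_def)
    moreover have "(u, v) \<in> connected_in ?G"
      by (rule connected_in_edge[of "(r, {u, v})"]) (auto simp: add_edge_def)
    ultimately show ?thesis by (auto simp: t'eq add_edge_def)
  qed
qed

end

text \<open>\<open>D\<close> holds the grades treated before \<open>x\<close>. Since it is a
  down-set without \<open>x\<close>, no generator of grade \<open>x\<close> lies below a treated
  grade.\<close>

locale processing_step = finite_poset_tower P K for P :: "'p::order set" and K :: "('p, 'v) tower" +
  fixes D :: "'p set" and x :: 'p and s :: "('p, 'v) state"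
  assumes x: "x \<in> P" "x \<notin> D" and below: "\<And>y. y \<in> P \<Longrightarrow> y < x \<Longrightarrow> y \<in> D"
    and D: "D \<subseteq> P" "\<And>y z. y \<in> D \<Longrightarrow> z \<in> P \<Longrightarrow> z \<le> y \<Longrightarrow> z \<in> D"
    and processed: "processed D s"
begin

lemma covers_D: "covers P y x \<Longrightarrow> y \<in> D \<and> y \<in> P \<and> y < x"
  using below by (auto simp: covers_def)

text \<open>Take a maximal element of the finite interval from \<open>z\<close> up to but excluding
  \<open>x\<close>. Through it every older generator enters grade \<open>x\<close> from a finished
  grade.\<close>

lemma ex_cover:
  assumes "z \<in> P" "z < x"
  shows "\<exists>y. covers P y x \<and> z \<le> y"
proof -
  let ?A = "{y \<in> P. z \<le> y \<and> y < x}"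
  have "finite ?A" "z \<in> ?A" using assms finite_P by auto
  then obtain y where y: "y \<in> ?A" "\<And>y'. y' \<in> ?A \<Longrightarrow> y \<le> y' \<Longrightarrow> y' = y"
    using finite_has_maximal[of ?A] by (metis (no_types, lifting) empty_iff)
  have "False" if "w \<in> P" "y < w" "w < x" for w
    using y(1) y(2)[of w] that by force
  then have "covers P y x" unfolding covers_def using y(1) x(1) by blast
  then show ?thesis using y by blast
qed

text \<open>If there is no event at \<open>v\<close>, the vertex map fixes \<open>v\<close>, so the
  default value is the right one.\<close>

lemma event_map_eq:
  assumes "covers P y x" "\<sigma> \<in> cpx K y" "v \<in> \<sigma>"
  shows "event_map P K y x v = vmap K y x v"
proof -
  have y: "y \<in> P" "y \<le> x" using covers_D[OF assms(1)] by auto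
  have v: "{v} \<in> cpx K y" using cpx_vertex y assms by blast
  then have "{vmap K y x v} \<in> cpx K x" using cpx_image[OF y(1) x(1) y(2) v] by simp
  then have "(y, x, v, w) \<in> edge_events P K \<longleftrightarrow> w = vmap K y x v \<and> v \<noteq> w" for w
    using assms(1) v by (auto simp: edge_events_def)
  then show ?thesis by (auto simp: event_map_def)
qed

lemma grade_D: "y \<in> D \<Longrightarrow> grade_ok s y"
  using processed by (simp add: processed_def)

lemma act_D:
  assumes "covers P y x" "(\<sigma>, g) \<in> act s y"
  shows "g \<in> gens_upto y" "alive y g" "image_at y g = \<sigma>" "\<sigma> \<in> cpx K y"
    and "image_at x g = vmap K y x ` \<sigma>" "alive x g \<longleftrightarrow> inj_on (vmap K y x) \<sigma>"
    and "g \<in> gens_upto x" "fst g \<noteq> x"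
proof -
  have y: "y \<in> D" "y \<in> P" "y < x" using covers_D[OF assms(1)] by auto
  have "act_ok y (act s y)" using grade_D[OF y(1)] by (simp add: grade_ok_def)
  from act_okD[OF this assms(2)]
  show *: "g \<in> gens_upto y" "alive y g" "image_at y g = \<sigma>" .
  show "\<sigma> \<in> cpx K y" using image_at_cpx[OF *(1) y(2)] *(3) by simp
  show "image_at x g = vmap K y x ` \<sigma>" "alive x g \<longleftrightarrow> inj_on (vmap K y x) \<sigma>"
    using image_at_comp[OF *(1) _ x(1) y(2)] alive_comp[OF *(1) _ x(1) y(2)] y(3) *(2,3) by auto
  show "g \<in> gens_upto x" using gens_upto_mono[OF *(1)] y(3) by simp
  show "fst g \<noteq> x" using gens_uptoD(3)[OF *(1)] y(3) by auto
qed

section \<open>The routine Collapse\<close>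

definition collapsed :: "('p, 'v) state \<Rightarrow> bool" where
  "collapsed t \<longleftrightarrow> working D x s t \<and>
     (\<forall>g\<in>gens_upto x. fst g \<noteq> x \<longrightarrow> represents x (act t x) (graph t x) g) \<and>
     (\<forall>\<tau>\<in>cpx K x. (x, \<tau>) \<notin> generators P K \<longrightarrow> (\<exists>g. (\<tau>, g) \<in> act t x))"

definition collapse_ready :: "('p, 'v) state \<Rightarrow> bool" where
  "collapse_ready t \<longleftrightarrow> working D x s t \<and>
     (\<forall>y. covers P y x \<longrightarrow> edges (forest s y) \<subseteq> edges (graph t x))"

text \<open>The outcome of one iteration, in a form that later iterations preserve: during the loop
  \<open>act t x\<close> and the edges of the graph only grow.\<close>

definition transferred :: "('p, 'v) state \<Rightarrow> 'p \<Rightarrow> 'v set \<Rightarrow> ('p, 'v) gen \<Rightarrow> bool" where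
  "transferred t y \<sigma> g \<longleftrightarrow> (if inj_on (vmap K y x) \<sigma> then (vmap K y x ` \<sigma>, g) \<in> act t x
     else (Omega, Gen g) \<in> connected_in (graph t x))"

lemma collapse_ready_init: "collapse_ready (collapse_init P x s)"
proof -
  let ?t = "collapse_init P x s"
  have fr: "frame x s ?t" by (simp add: frame_def collapse_init_def)
  have rels: "rels_ok (insert x D) ?t"
    using processed by (auto simp: processed_def rels_ok_def collapse_init_def)
  have forest: "graph_ok (rels s) (p1 s) y (forest s y)" if "covers P y x" for y
    using grade_D covers_D[OF that] by (simp add: grade_ok_def)
  show ?thesis
  proof (cases "\<exists>y\<in>P. y < x")
    case True
    let ?C = "{y. covers P y x}"
    have G: "graph ?t x = \<lparr>verts = (\<Union>y\<in>?C. verts (forest s y)), edges = (\<Union>y\<in>?C. edges (forest s y))\<rparr>"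
      using True by (simp add: collapse_init_def)
    have finC: "finite ?C" by (rule finite_subset[OF _ finite_P]) (auto simp: covers_def)
    \<comment> \<open>A grade that is not minimal has a cover, which brings \<open>Omega\<close>
      into the union.\<close>
    obtain y0 where y0: "covers P y0 x" using True ex_cover by blast
    have wf: "wf_mgraph (forest s y)" if "covers P y x" for y using forest[OF that] by (simp add: graph_ok_def)
    have "wf_mgraph (graph ?t x)"
      unfolding wf_mgraph_def G using finC wf by (auto simp: wf_mgraph_def)
    moreover have "Omega \<in> verts (graph ?t x)" using y0 forest[OF y0] by (auto simp: G graph_ok_def)
    moreover have "verts (graph ?t x) \<subseteq> insert Omega (Gen ` gens_upto x)"
    proof
      fix n assume "n \<in> verts (graph ?t x)"
      then obtain y where y: "covers P y x" "n \<in> verts (forest s y)" by (auto simp: G)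
      then show "n \<in> insert Omega (Gen ` gens_upto x)"
        using forest[OF y(1)] covers_D[OF y(1)] gens_upto_mono[of _ y x] unfolding graph_ok_def by auto
    qed
    moreover have "fst e \<in> rels s \<and> fst (fst e) \<le> x \<and> (\<forall>g. p1 s g (fst e) = of_bool (Gen g \<in> snd e))"
      if e: "e \<in> edges (graph ?t x)" for e
    proof -
      obtain y where y: "covers P y x" "e \<in> edges (forest s y)" using e unfolding G by auto
      then have "fst (fst e) \<le> y" "fst e \<in> rels s" "\<forall>g. p1 s g (fst e) = of_bool (Gen g \<in> snd e)"
        using forest[OF y(1)] by (simp_all add: graph_ok_def)
      then show ?thesis using covers_D[OF y(1)] by auto
    qed
    ultimately have "graph_ok (rels ?t) (p1 ?t) x (graph ?t x)"
      unfolding graph_ok_def by (simp add: collapse_init_def)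
    moreover have "Gen g \<in> verts (graph ?t x)" if g: "g \<in> gens_upto x" "fst g \<noteq> x" for g
    proof -
      obtain y where y: "covers P y x" "fst g \<le> y"
        using ex_cover[of "fst g"] gens_uptoD[OF g(1)] g(2) by (auto simp: less_le)
      then have "g \<in> gens_upto y" using g(1) by (simp add: gens_upto_def)
      then have "Gen g \<in> verts (forest s y)"
        using grade_D[of y] covers_D[OF y(1)] by (auto simp: grade_ok_def)
      then show ?thesis using y(1) by (auto simp: G)
    qed
    ultimately show ?thesis
      using fr rels by (auto simp: collapse_ready_def working_def G act_ok_def) (auto simp: collapse_init_def)
  next
    case False
    then have G: "graph ?t x = \<lparr>verts = {Omega}, edges = {}\<rparr>" by (auto simp: collapse_init_def)
    have none: "fst g = x" if "g \<in> gens_upto x" for g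
      using gens_uptoD[OF that] False by (auto simp: less_le)
    have nocov: "\<not> covers P y x" for y using covers_D False by blast
    have "graph_ok (rels ?t) (p1 ?t) x (graph ?t x)"
      unfolding graph_ok_def G by (simp add: wf_mgraph_def)
    then show ?thesis
      using fr rels none nocov by (auto simp: collapse_ready_def working_def act_ok_def) (auto simp: collapse_init_def)
  qed
qed

text \<open>\<open>Q\<close> stands for the pairs treated in earlier iterations, which have to stay
  transferred.\<close>

lemma achieves_collapse_step:
  assumes cov: "covers P y x" "(\<sigma>, g) \<in> act s y" and rdy: "collapse_ready t"
    and old: "\<And>y \<sigma> g. Q y \<sigma> g \<Longrightarrow> transferred t y \<sigma> g"
  shows "achieves (collapse_step P K x (y, \<sigma>, g)) t
    (\<lambda>t'. collapse_ready t' \<and> transferred t' y \<sigma> g \<and> (\<forall>y \<sigma> g. Q y \<sigma> g \<longrightarrow> transferred t' y \<sigma> g))"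
proof -
  note g = act_D[OF cov]
  have w: "working D x s t" using rdy by (simp add: collapse_ready_def)
  have inj: "inj_on (event_map P K y x) \<sigma> \<longleftrightarrow> inj_on (vmap K y x) \<sigma>"
    by (rule inj_on_cong) (rule event_map_eq[OF cov(1) g(4)])
  have vg: "Gen g \<in> verts (graph t x)" "Omega \<in> verts (graph t x)"
    using w g(7,8) by (auto simp: working_def graph_ok_def)
  show ?thesis
  proof (cases "inj_on (vmap K y x) \<sigma>")
    case True
    let ?t = "t\<lparr>act := (act t)(x := insert (vmap K y x ` \<sigma>, g) (act t x))\<rparr>"
    have "frame x t ?t" by (simp add: frame_def)
    then have "frame x s ?t" using w frame_trans by (auto simp: working_def)
    moreover have "act_ok x (act ?t x)"
      using w g True by (auto simp: working_def act_ok_def)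
    ultimately have "collapse_ready ?t"
      using rdy vg by (auto simp: collapse_ready_def working_def rels_ok_def)
    moreover have "transferred ?t y' \<sigma>' g'" if "Q y' \<sigma>' g'" for y' \<sigma>' g'
      using old[OF that] by (auto simp: transferred_def split: if_splits)
    moreover have "transferred ?t y \<sigma> g" using True by (simp add: transferred_def)
    ultimately show ?thesis
      unfolding achieves_def collapse_step_def prod.case inj using True by simp
  next
    case False
    have "relation_ok (\<lambda>h r. of_bool (Gen h \<in> {Omega, Gen g})) r" if "fst r = x" for r
      unfolding relation_ok_def using g(6,7) False that by auto
    from achieves_try_relation[OF w _ vg(2,1) this]
    have "achieves (try_relation x Omega (Gen g)) t
      (\<lambda>t'. collapse_ready t' \<and> transferred t' y \<sigma> g \<and> (\<forall>y \<sigma> g. Q y \<sigma> g \<longrightarrow> transferred t' y \<sigma> g))"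
    proof (rule achieves_mono)
      fix t'
      assume t': "working D x s t' \<and> act t' = act t \<and> f0 t' = f0 t \<and> verts (graph t' x) = verts (graph t x) \<and>
        edges (graph t x) \<subseteq> edges (graph t' x) \<and> (Omega, Gen g) \<in> connected_in (graph t' x)"
      then have "collapse_ready t'" using rdy unfolding collapse_ready_def by blast
      moreover have "transferred t' y' \<sigma>' g'" if "Q y' \<sigma>' g'" for y' \<sigma>' g'
        using old[OF that] t' connected_in_mono[of "graph t x" "graph t' x"]
        unfolding transferred_def by (auto split: if_splits)
      moreover have "transferred t' y \<sigma> g" using t' False by (simp add: transferred_def)
      ultimately show "collapse_ready t' \<and> transferred t' y \<sigma> g \<and> (\<forall>y \<sigma> g. Q y \<sigma> g \<longrightarrow> transferred t' y \<sigma> g)"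
        by blast
    qed simp
    then show ?thesis using inj False by (simp add: collapse_step_def)
  qed
qed

lemma achieves_collapse: "achieves (collapse P K x) s collapsed"
proof -
  let ?A = "{(y, \<sigma>, g). covers P y x \<and> (\<sigma>, g) \<in> act s y}"
  define I where "I B t \<longleftrightarrow> collapse_ready t \<and> (\<forall>y \<sigma> g. (y, \<sigma>, g) \<in> B \<longrightarrow> transferred t y \<sigma> g)" for B t
  have "?A \<subseteq> (\<Union>y\<in>{y. covers P y x}. Pair y ` act s y)" by auto
  moreover have "finite {y. covers P y x}" by (rule finite_subset[OF _ finite_P]) (auto simp: covers_def)
  moreover have "finite (act s y)" if "covers P y x" for y
    using grade_D[of y] covers_D[OF that] act_ok_finite[of y] by (simp add: grade_ok_def)
  ultimately have "finite ?A" by (auto intro: finite_subset)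
  then have "achieves (foreach ?A (collapse_step P K x)) (collapse_init P x s) (I ?A)"
  proof (rule achieves_foreach)
    show "I {} (collapse_init P x s)" using collapse_ready_init by (simp add: I_def)
  next
    fix B a t
    assume "B \<subseteq> ?A" "a \<in> ?A" and I: "I B t"
    then obtain y \<sigma> g where a: "a = (y, \<sigma>, g)" "covers P y x" "(\<sigma>, g) \<in> act s y" by blast
    have "achieves (collapse_step P K x (y, \<sigma>, g)) t (\<lambda>t'. collapse_ready t' \<and> transferred t' y \<sigma> g \<and>
        (\<forall>y \<sigma> g. (y, \<sigma>, g) \<in> B \<longrightarrow> transferred t' y \<sigma> g))"
      using achieves_collapse_step[OF a(2,3), of t "\<lambda>y \<sigma> g. (y, \<sigma>, g) \<in> B"] I by (simp add: I_def)
    then show "achieves (collapse_step P K x a) t (I (insert a B))"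
      unfolding a(1) by (rule achieves_mono) (auto simp: I_def)
  qed
  then have "achieves (collapse P K x) s (I ?A)"
    by (simp add: achieves_def collapse_def)
  then show ?thesis
  proof (rule achieves_mono)
    fix t
    assume "I ?A t"
    then have rdy: "collapse_ready t"
      and tr: "\<And>y \<sigma> g. covers P y x \<Longrightarrow> (\<sigma>, g) \<in> act s y \<Longrightarrow> transferred t y \<sigma> g"
      by (auto simp: I_def)
    have "represents x (act t x) (graph t x) g" if g: "g \<in> gens_upto x" "fst g \<noteq> x" for g
    proof -
      obtain y where y: "covers P y x" "fst g \<le> y"
        using ex_cover[of "fst g"] gens_uptoD[OF g(1)] g(2) by (auto simp: less_le)
      note yD = covers_D[OF y(1)]
      have gy: "g \<in> gens_upto y" using g(1) y(2) by (simp add: gens_upto_def)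
      then have rep: "represents y (act s y) (forest s y) g" using grade_D yD by (simp add: grade_ok_def)
      have mono: "connected_in (forest s y) \<subseteq> connected_in (graph t x)"
        using rdy y(1) by (intro connected_in_mono) (simp add: collapse_ready_def)
      have "y \<le> x" "y \<in> P" using yD by auto
      note comp = alive_comp[OF gy this(1) x(1) this(2)] image_at_comp[OF gy this(1) x(1) this(2)]
      show ?thesis
      proof (cases "alive y g")
        case False
        then show ?thesis using rep mono comp yD by (auto simp: represents_def)
      next
        case True
        then obtain g' where g': "(image_at y g, g') \<in> act s y" "(Gen g, Gen g') \<in> connected_in (graph t x)"
          using rep mono by (auto simp: represents_def)
        \<comment> \<open>Only representatives are passed on from \<open>y\<close>. The generator
          \<open>g\<close> is connected to its representative \<open>g'\<close> and shares its fate
          at \<open>x\<close>.\<close>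
        have "transferred t y (image_at y g) g'" by (rule tr[OF y(1) g'(1)])
        then show ?thesis
          using True comp g'(2) connected_in_trans[OF g'(2) connected_in_sym[of Omega]]
          unfolding represents_def transferred_def by auto
      qed
    qed
    moreover have "\<exists>g. (\<tau>, g) \<in> act t x" if \<tau>: "\<tau> \<in> cpx K x" "(x, \<tau>) \<notin> generators P K" for \<tau>
    proof -
      obtain y \<rho> where y: "covers P y x" "\<rho> \<in> cpx K y" "\<tau> = vmap K y x ` \<rho>"
        using \<tau> x(1) by (auto simp: generators_def)
      note yD = covers_D[OF y(1)]
      \<comment> \<open>The simplex above \<open>\<tau>\<close> may itself degenerate, but one of
        its faces is mapped bijectively onto \<open>\<tau>\<close>, and the representative of that
        face is passed on.\<close>
      obtain \<rho>' where r: "\<rho>' \<subseteq> \<rho>" "\<tau> = vmap K y x ` \<rho>'" "inj_on (vmap K y x) \<rho>'"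
        using y(3) by (metis order_refl subset_image_inj)
      have "\<rho>' \<noteq> {}" using cpx_simplex_nonempty[OF x(1) \<tau>(1)] r(2) by auto
      then have "\<rho>' \<in> cpx K y" using cpx_face yD y(2) r(1) by blast
      then obtain g where "(\<rho>', g) \<in> act s y" using grade_D[of y] yD unfolding grade_ok_def by blast
      then show ?thesis using tr[OF y(1), of \<rho>' g] r by (auto simp: transferred_def)
    qed
    ultimately show "collapsed t" using rdy by (auto simp: collapsed_def collapse_ready_def)
  qed
qed

end

context processing_step
begin

section \<open>The routine Generator: new simplices, merging, spanning forest\<close>

definition new_gens :: "('p, 'v) gen set" where
  "new_gens = {g \<in> generators P K. fst g = x}"

definition generating :: "('p, 'v) gen set \<Rightarrow> ('p, 'v) state \<Rightarrow> bool" where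
  "generating N t \<longleftrightarrow> working D x s t \<and>
     (\<forall>g\<in>gens_upto x. fst g \<noteq> x \<or> g \<in> N \<longrightarrow>
        Gen g \<in> verts (graph t x) \<and> represents x (act t x) (graph t x) g) \<and>
     (\<forall>\<tau>\<in>cpx K x. (x, \<tau>) \<notin> generators P K \<or> (x, \<tau>) \<in> N \<longrightarrow> (\<exists>g. (\<tau>, g) \<in> act t x)) \<and>
     (\<forall>g\<in>N. boundary_ok (f0 t) g)"

lemma generating_empty: "collapsed t \<Longrightarrow> generating {} t"
  by (simp add: collapsed_def generating_def working_def)

text \<open>The facets can be found for two reasons: a facet that is not a new generator was carried
  over by Collapse, and one that is has been added before, by assumption
  \<open>facets\<close>.\<close>

lemma achieves_add_generator:
  assumes gen: "generating N t" and \<sigma>: "(x, \<sigma>) \<in> generators P K" "(x, \<sigma>) \<notin> N"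
    and facets: "\<And>\<tau>. \<tau> \<in> facets \<sigma> \<Longrightarrow> (x, \<tau>) \<in> generators P K \<Longrightarrow> (x, \<tau>) \<in> N"
  shows "achieves (add_generator (x, \<sigma>)) t (generating (insert (x, \<sigma>) N))"
proof (rule achievesI)
  let ?g = "(x, \<sigma>)"
  define t1 where "t1 = t\<lparr>act := (act t)(x := insert (\<sigma>, ?g) (act t x)),
    graph := (graph t)(x := add_vertex (Gen ?g) (graph t x))\<rparr>"
  have gD: "?g \<in> gens_upto x" "\<sigma> \<in> cpx K x" "alive x ?g" "image_at x ?g = \<sigma>"
    using generatorsD[OF \<sigma>(1)] alive_self[OF \<sigma>(1)] image_at_self[OF \<sigma>(1)] by simp_all
  have w: "working D x s t" using gen by (simp add: generating_def)
  have act1: "act t1 x = insert (\<sigma>, ?g) (act t x)"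
    and verts1: "verts (graph t1 x) = insert (Gen ?g) (verts (graph t x))"
    and edges1: "edges (graph t1 x) = edges (graph t x)"
    by (simp_all add: t1_def add_vertex_def)
  have step: "add_generator ?g t t' \<longleftrightarrow> (\<exists>\<phi>. (\<forall>\<tau>\<in>facets \<sigma>. (\<tau>, \<phi> \<tau>) \<in> act t1 x) \<and>
      t' = t1\<lparr>f0 := set_column (f0 t1) ?g (\<lambda>g. of_bool (g \<in> \<phi> ` facets \<sigma>))\<rparr>)" for t'
    by (simp add: add_generator_def Let_def t1_def)
  have "\<exists>g. (\<tau>, g) \<in> act t1 x" if \<tau>: "\<tau> \<in> facets \<sigma>" for \<tau>
  proof -
    have "\<tau> \<in> cpx K x" using \<tau> cpx_face[OF x(1) gD(2)] by (simp add: facets_def)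
    then have "\<exists>g. (\<tau>, g) \<in> act t x" using gen facets[OF \<tau>] unfolding generating_def by blast
    then show ?thesis using act1 by blast
  qed
  then obtain \<phi> where "\<forall>\<tau>\<in>facets \<sigma>. (\<tau>, \<phi> \<tau>) \<in> act t1 x" by metis
  then show "\<exists>t'. add_generator ?g t t'" using step by blast
  have ao: "act_ok x (act t1 x)"
    using w gD unfolding act1 act_ok_def by (simp add: working_def act_ok_def)
  fix t'
  assume "add_generator ?g t t'"
  then obtain \<phi> where \<phi>: "\<And>\<tau>. \<tau> \<in> facets \<sigma> \<Longrightarrow> (\<tau>, \<phi> \<tau>) \<in> act t1 x"
    and t': "t' = t1\<lparr>f0 := set_column (f0 t1) ?g (\<lambda>g. of_bool (g \<in> \<phi> ` facets \<sigma>))\<rparr>"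
    using step by blast
  have same: "act t' = act t1" "graph t' = graph t1" "rels t' = rels t" "p1 t' = p1 t"
    and f0: "f0 t' = set_column (f0 t) ?g (\<lambda>g. of_bool (g \<in> \<phi> ` facets \<sigma>))"
    by (simp_all add: t' t1_def)
  have "frame x t t'"
    by (simp add: frame_def t' t1_def) (auto simp: set_column_def)
  then have "frame x s t'" using w frame_trans by (auto simp: working_def)
  moreover have "rels_ok (insert x D) t'"
    using w by (simp add: working_def rels_ok_def same)
  moreover have "graph_ok (rels t') (p1 t') x (graph t' x)"
    using w gD(1) unfolding same working_def graph_ok_def wf_mgraph_def verts1 edges1 by auto
  moreover have "\<forall>g\<in>gens_upto x. fst g \<noteq> x \<longrightarrow> Gen g \<in> verts (graph t' x)"
    and "\<forall>\<tau> g. (\<tau>, g) \<in> act t' x \<longrightarrow> Gen g \<in> verts (graph t' x)"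
    using w unfolding same act1 verts1 working_def by simp_all
  ultimately have "working D x s t'"
    using ao unfolding working_def same(1) by blast
  moreover have "Gen g \<in> verts (graph t' x) \<and> represents x (act t' x) (graph t' x) g"
    if g: "g \<in> gens_upto x" "fst g \<noteq> x \<or> g \<in> insert ?g N" for g
  proof (cases "g = ?g")
    case True
    then show ?thesis using gD unfolding same act1 verts1 by (auto simp: represents_def)
  next
    case False
    then have "Gen g \<in> verts (graph t x)" "represents x (act t x) (graph t x) g"
      using gen g unfolding generating_def by blast+
    then show ?thesis unfolding same act1 verts1
      using represents_mono[of x "act t x" "graph t x" g _ "graph t1 x"] edges1 by blast
  qed
  moreover have "\<exists>g. (\<tau>, g) \<in> act t' x"
    if "\<tau> \<in> cpx K x" "(x, \<tau>) \<notin> generators P K \<or> (x, \<tau>) \<in> insert ?g N" for \<tau>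
    using that gen unfolding same act1 generating_def by blast
  moreover have "boundary_ok (f0 t') g" if "g \<in> insert ?g N" for g
  proof (cases "g = ?g")
    case True
    have "\<phi> \<tau> \<in> gens_upto x \<and> alive x (\<phi> \<tau>) \<and> image_at x (\<phi> \<tau>) = \<tau>" if "\<tau> \<in> facets \<sigma>" for \<tau>
      using act_okD[OF ao \<phi>[OF that]] by blast
    then show ?thesis
      unfolding boundary_ok_def True f0 by (intro exI[of _ \<phi>]) (simp add: set_column_def)
  next
    case False
    then have "boundary_ok (f0 t) g" using gen that unfolding generating_def by blast
    moreover have "boundary_ok (f0 t') g \<longleftrightarrow> boundary_ok (f0 t) g"
      by (rule boundary_ok_cong) (use False in \<open>simp add: f0 set_column_def\<close>)
    ultimately show ?thesis by blast
  qed
  ultimately show "generating (insert ?g N) t'" unfolding generating_def by blast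
qed

lemma achieves_add_generators:
  assumes "collapsed t"
  shows "achieves (add_generators P K x) t (generating new_gens)"
proof -
  let ?key = "\<lambda>g::('p, 'v) gen. sdim (snd g)"
  have *: "achieves (foreach_list add_generator gs) t (generating new_gens)"
    if gs: "distinct gs" "set gs = new_gens" "sorted (map ?key gs)" for gs
  proof -
    have "achieves (foreach_list add_generator gs) t (generating (set gs))"
    proof (rule achieves_foreach_list)
      show "generating (set []) t" using generating_empty assms by simp
    next
      fix ps g qs t'
      assume split: "gs = ps @ g # qs" and gen: "generating (set ps) t'"
      then have "g \<in> new_gens" using gs(2) by auto
      then obtain \<sigma> where g: "g = (x, \<sigma>)" "g \<in> generators P K" by (cases g) (auto simp: new_gens_def)
      have "(x, \<tau>) \<in> set ps" if \<tau>: "\<tau> \<in> facets \<sigma>" "(x, \<tau>) \<in> generators P K" for \<tau>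
      proof (rule ccontr)
        assume "(x, \<tau>) \<notin> set ps"
        moreover have "(x, \<tau>) \<in> set gs" using \<tau>(2) gs(2) by (simp add: new_gens_def)
        ultimately have "(x, \<tau>) \<in> set (g # qs)" using split by simp
        then have "sdim \<sigma> \<le> sdim \<tau>"
          using gs(3) g(1) unfolding split by (auto simp: sorted_append)
        then show False using \<tau>(1) by (simp add: facets_def)
      qed
      moreover have "g \<notin> set ps" using gs(1) split by auto
      ultimately show "achieves (add_generator g) t' (generating (set (ps @ [g])))"
        using achieves_add_generator[OF gen, of \<sigma>] g by simp
    qed
    then show ?thesis using gs(2) by simp
  qed
  have "finite new_gens" using finite_generators by (simp add: new_gens_def)
  then obtain l where l: "distinct l" "set l = new_gens" using finite_distinct_list by blast
  then have "distinct (sort_key ?key l)" "set (sort_key ?key l) = new_gens" "sorted (map ?key (sort_key ?key l))"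
    by simp_all
  then show ?thesis
    using * unfolding achieves_def add_generators_def new_gens_def[symmetric] by blast
qed

text \<open>Dropping the pair of \<open>g'\<close> loses nothing: whatever was represented by
  \<open>g'\<close> is now connected to \<open>g\<close>, which has the same image.\<close>

lemma merge_step_preserves:
  assumes gen: "generating new_gens t" and g: "(\<sigma>, g) \<in> act t x" "(\<sigma>, g') \<in> act t x" "g \<noteq> g'"
  shows "achieves (try_relation x (Gen g) (Gen g')) t
    (\<lambda>u. generating new_gens (u\<lparr>act := (act u)(x := act u x - {(\<sigma>, g')})\<rparr>) \<and> act u = act t)"
proof -
  have w: "working D x s t" using gen by (simp add: generating_def)
  then have ao: "act_ok x (act t x)" and v: "Gen g \<in> verts (graph t x)" "Gen g' \<in> verts (graph t x)"
    using g unfolding working_def by blast+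
  note gD = act_okD[OF ao g(1)] act_okD[OF ao g(2)]
  have "relation_ok (\<lambda>h r. of_bool (Gen h \<in> {Gen g, Gen g'})) r" if "fst r = x" for r
    unfolding relation_ok_def using gD g(3) that
    by (intro disjI2 bexI[of _ g] bexI[of _ g']) auto
  from achieves_try_relation[OF w _ v this] g(3)
  have "achieves (try_relation x (Gen g) (Gen g')) t (\<lambda>u. working D x s u \<and> act u = act t \<and> f0 u = f0 t \<and>
    verts (graph u x) = verts (graph t x) \<and> edges (graph t x) \<subseteq> edges (graph u x) \<and>
    (Gen g, Gen g') \<in> connected_in (graph u x))" by simp
  then show ?thesis
  proof (rule achieves_mono)
    fix u
    assume u: "working D x s u \<and> act u = act t \<and> f0 u = f0 t \<and>
      verts (graph u x) = verts (graph t x) \<and> edges (graph t x) \<subseteq> edges (graph u x) \<and>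
      (Gen g, Gen g') \<in> connected_in (graph u x)"
    let ?A = "act t x - {(\<sigma>, g')}"
    let ?u = "u\<lparr>act := (act u)(x := act u x - {(\<sigma>, g')})\<rparr>"
    have act: "act ?u x = ?A" and same: "graph ?u = graph u" "rels ?u = rels u" "p1 ?u = p1 u" "f0 ?u = f0 t"
      using u by simp_all
    have "frame x u ?u" by (simp add: frame_def)
    then have "frame x s ?u" using u frame_trans by (auto simp: working_def)
    moreover have "act_ok x ?A" using ao by (simp add: act_ok_def)
    moreover have "rels_ok (insert x D) ?u" using u by (simp add: working_def rels_ok_def)
    moreover have "graph_ok (rels u) (p1 u) x (graph u x)"
      "\<forall>k\<in>gens_upto x. fst k \<noteq> x \<longrightarrow> Gen k \<in> verts (graph u x)" using u unfolding working_def by blast+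
    moreover have "\<forall>\<tau> k. (\<tau>, k) \<in> ?A \<longrightarrow> Gen k \<in> verts (graph u x)"
    proof (intro allI impI)
      fix \<tau> k assume "(\<tau>, k) \<in> ?A"
      then have "(\<tau>, k) \<in> act u x" using u by simp
      moreover have "working D x s u" using u by blast
      ultimately show "Gen k \<in> verts (graph u x)" unfolding working_def by blast
    qed
    ultimately have "working D x s ?u" unfolding working_def act same by blast
    moreover have "represents x ?A (graph u x) k" if k: "k \<in> gens_upto x" for k
    proof -
      have "represents x (act t x) (graph t x) k"
        using gen gens_uptoD(1)[OF k] k unfolding generating_def new_gens_def by blast
      then have rep: "represents x (act t x) (graph u x) k" using u represents_mono by blast
      show ?thesis
      proof (cases "alive x k")
        case True
        then obtain k' where k': "(image_at x k, k') \<in> act t x" "(Gen k, Gen k') \<in> connected_in (graph u x)"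
          using rep unfolding represents_def by auto
        show ?thesis
        proof (cases "(image_at x k, k') = (\<sigma>, g')")
          case True
          then have "(image_at x k, g) \<in> ?A" using g by simp
          moreover have "(Gen k, Gen g) \<in> connected_in (graph u x)"
          proof (rule connected_in_trans)
            show "(Gen k, Gen g') \<in> connected_in (graph u x)" using k'(2) True by simp
            show "(Gen g', Gen g) \<in> connected_in (graph u x)" using u by (simp add: connected_in_sym)
          qed
          ultimately show ?thesis using \<open>alive x k\<close> unfolding represents_def by auto
        next
          case False
          then show ?thesis using \<open>alive x k\<close> k' unfolding represents_def by auto
        qed
      next
        case False
        then show ?thesis using rep by (simp add: represents_def)
      qed
    qed
    moreover have "Gen k \<in> verts (graph u x)" if "k \<in> gens_upto x" for k
      using gen u gens_uptoD(1)[OF that] that unfolding generating_def new_gens_def by auto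
    moreover have "\<exists>k. (\<tau>, k) \<in> ?A" if \<tau>: "\<tau> \<in> cpx K x" for \<tau>
    proof -
      obtain k where "(\<tau>, k) \<in> act t x"
        using gen \<tau> unfolding generating_def new_gens_def by auto
      then show ?thesis using g by (cases "(\<tau>, k) = (\<sigma>, g')") auto
    qed
    moreover have "\<forall>k\<in>new_gens. boundary_ok (f0 t) k" using gen unfolding generating_def by blast
    ultimately show "generating new_gens ?u \<and> act u = act t"
      using u unfolding generating_def act same by blast
  qed
qed

definition unambiguous :: "('p, 'v) state \<Rightarrow> bool" where
  "unambiguous t \<longleftrightarrow> (\<forall>\<sigma> g g'. (\<sigma>, g) \<in> act t x \<longrightarrow> (\<sigma>, g') \<in> act t x \<longrightarrow> g = g')"

text \<open>Every step deletes a pair from the finite set \<open>act t x\<close>, so the loop can be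
  run to its end.\<close>

lemma achieves_merge:
  assumes "generating new_gens t"
  shows "achieves (merge x) t (\<lambda>t'. generating new_gens t' \<and> unambiguous t')"
proof (rule achievesI)
  show "\<exists>t'. merge x t t'"
    using assms
  proof (induction "card (act t x)" arbitrary: t rule: less_induct)
    case less
    show ?case
    proof (cases "unambiguous t")
      case True
      then have "merge x t t" unfolding merge_def unambiguous_def by blast
      then show ?thesis ..
    next
      case False
      then obtain \<sigma> g g' where g: "(\<sigma>, g) \<in> act t x" "(\<sigma>, g') \<in> act t x" "g \<noteq> g'"
        unfolding unambiguous_def by blast
      obtain u where u: "try_relation x (Gen g) (Gen g') t u" "act u = act t"
        "generating new_gens (u\<lparr>act := (act u)(x := act u x - {(\<sigma>, g')})\<rparr>)"
        using merge_step_preserves[OF less.prems g] unfolding achieves_def by blast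
      let ?u = "u\<lparr>act := (act u)(x := act u x - {(\<sigma>, g')})\<rparr>"
      have step: "merge_step x t ?u" unfolding merge_step_def using g u(1) by blast
      have "finite (act t x)"
        using less.prems act_ok_finite unfolding generating_def working_def by blast
      then have "card (act ?u x) < card (act t x)"
        using g(2) u(2) by (simp add: card_Diff1_less del: card_Diff_insert)
      then obtain t' where "merge x ?u t'" using less.hyps u(3) by blast
      then have "merge x t t'"
        using step unfolding merge_def by (meson converse_rtranclp_into_rtranclp)
      then show ?thesis ..
    qed
  qed
next
  fix t'
  assume m: "merge x t t'"
  then have "(merge_step x)\<^sup>*\<^sup>* t t'" by (simp add: merge_def)
  then have "generating new_gens t'"
  proof (induction rule: rtranclp_induct)
    case base
    show ?case by (fact assms)
  next
    case (step u u')
    then obtain \<sigma> g g' v where g: "(\<sigma>, g) \<in> act u x" "(\<sigma>, g') \<in> act u x" "g \<noteq> g'"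
      and v: "try_relation x (Gen g) (Gen g') u v" "u' = v\<lparr>act := (act v)(x := act v x - {(\<sigma>, g')})\<rparr>"
      unfolding merge_step_def by blast
    show ?case using merge_step_preserves[OF step.IH g] v unfolding achieves_def by blast
  qed
  then show "generating new_gens t' \<and> unambiguous t'"
    using m unfolding merge_def unambiguous_def by blast
qed

definition grade_done :: "('p, 'v) state \<Rightarrow> bool" where
  "grade_done t \<longleftrightarrow> frame x s t \<and> rels_ok (insert x D) t \<and> grade_ok t x \<and>
     (\<forall>g\<in>generators P K. fst g = x \<longrightarrow> boundary_ok (f0 t) g)"

text \<open>\<open>represents\<close> sees a graph only through its connectivity, which a spanning
  forest keeps.\<close>

lemma achieves_choose_forest:
  assumes gen: "generating new_gens t" and un: "unambiguous t"
  shows "achieves (choose_forest x) t grade_done"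
proof (rule achievesI)
  have w: "working D x s t" using gen by (simp add: generating_def)
  then have G: "graph_ok (rels t) (p1 t) x (graph t x)" by (simp add: working_def)
  then have "finite (edges (graph t x))" by (simp add: graph_ok_def wf_mgraph_def)
  then show "\<exists>t'. choose_forest x t t'"
    using spanning_forest_exists unfolding choose_forest_def by blast
  fix t'
  assume "choose_forest x t t'"
  then obtain F where F: "spanning_forest (graph t x) F" "t' = t\<lparr>forest := (forest t)(x := F)\<rparr>"
    unfolding choose_forest_def by blast
  then have F': "verts F = verts (graph t x)" "edges F \<subseteq> edges (graph t x)" "acyclic_mgraph F"
    "connected_in F = connected_in (graph t x)"
    by (auto simp: spanning_forest_def acyclic_mgraph_def)
  have "frame x t t'" by (simp add: frame_def F(2))
  then have "frame x s t'" using w frame_trans by (auto simp: working_def)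
  moreover have "rels_ok (insert x D) t'" using w by (simp add: working_def rels_ok_def F(2))
  moreover have "grade_ok t' x"
  proof -
    have same: "forest t' x = F" "rels t' = rels t" "p1 t' = p1 t" "act t' = act t" by (simp_all add: F(2))
    have "g \<in> new_gens \<or> fst g \<noteq> x" if "g \<in> gens_upto x" for g
      using gens_uptoD(1)[OF that] by (simp add: new_gens_def)
    then have "Gen g \<in> verts F" "represents x (act t x) F g" if "g \<in> gens_upto x" for g
      using gen that unfolding generating_def represents_def F' by meson+
    moreover have "\<forall>\<tau>\<in>cpx K x. \<exists>g. (\<tau>, g) \<in> act t x"
      using gen unfolding generating_def new_gens_def by auto
    moreover have "graph_ok (rels t) (p1 t) x F" by (rule graph_ok_edges_subset[OF G F'(1,2)])
    ultimately show ?thesis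
      using un w F'(3) unfolding grade_ok_def same unambiguous_def working_def by blast
  qed
  moreover have "\<forall>g\<in>generators P K. fst g = x \<longrightarrow> boundary_ok (f0 t') g"
    using gen unfolding generating_def new_gens_def by (simp add: F(2))
  ultimately show "grade_done t'" by (simp add: grade_done_def)
qed

section \<open>Stability of earlier grades, and the routine Lift\<close>

lemma processed_frame:
  assumes fr: "frame x s t" and y: "y \<in> D"
  shows "grade_ok t y" "lifted t y" and "g \<in> generators P K \<Longrightarrow> fst g = y \<Longrightarrow> boundary_ok (f0 t) g"
proof -
  have yx: "y \<noteq> x" "y \<in> P" using y x(2) D(1) by auto
  have rels: "rels s \<subseteq> rels t" "r \<in> rels t \<Longrightarrow> fst r \<noteq> x \<Longrightarrow> r \<in> rels s" for r
    using fr by (auto simp: frame_def)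
  have p: "p1 t h r = p1 s h r" if "r \<in> rels s" for h r using fr that by (simp add: frame_def)
  have f: "f0 t h k = f0 s h k" if "fst k \<noteq> x" for h k using fr that by (simp add: frame_def)
  have same: "act t y = act s y" "forest t y = forest s y" using fr yx(1) by (simp_all add: frame_def)
  have ok: "grade_ok s y" "lifted s y" using processed y by (simp_all add: processed_def)
  have "graph_ok (rels t) (p1 t) y (forest s y)"
  proof (rule graph_ok_mono[OF _ rels(1)])
    show "graph_ok (rels s) (p1 s) y (forest s y)" using ok(1) by (simp add: grade_ok_def)
  qed (rule p)
  then show "grade_ok t y" using ok(1) unfolding grade_ok_def same by blast
  have bd: "boundary_ok (f0 s) k" if "k \<in> generators P K" "fst k \<in> D" for k
    using processed that by (simp add: processed_def)
  show "boundary_ok (f0 t) g" if "g \<in> generators P K" "fst g = y"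
  proof -
    have "boundary_ok (f0 t) g \<longleftrightarrow> boundary_ok (f0 s) g"
      by (rule boundary_ok_cong) (use f yx that in simp)
    then show ?thesis using bd that y by simp
  qed
  \<comment> \<open>The columns of grade \<open>y\<close> involve only generators up to
    \<open>y\<close>. None of these has grade \<open>x\<close>, so the columns added to
    \<open>f0\<close> at \<open>x\<close> do not enter the products.\<close>
  have notx: "fst k \<noteq> x" if "k \<in> gens_upto y" for k
    using gens_uptoD(2,3)[OF that] D(2)[OF y] x(2) by auto
  have "mat_mult (generators P K) (f0 t) (p1 t) g r = mat_mult (generators P K) (f0 s) (p1 s) g r"
    if r: "r \<in> rels s" "fst r = y" for g r
    unfolding mat_mult_def
  proof (rule sum.cong[OF refl])
    fix k assume "k \<in> generators P K"
    have "relation_ok (p1 s) r" using processed r by (simp add: processed_def rels_ok_def)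
    then have "fst k \<noteq> x" if "p1 s k r \<noteq> 0" using relation_ok_support that r(2) notx by blast
    then show "f0 t g k * p1 t k r = f0 s g k * p1 s k r"
      using p[OF r(1)] f by (cases "p1 s k r = 0") auto
  qed
  moreover have "mat_mult (generators P K) (f0 t) (f0 t) h g = mat_mult (generators P K) (f0 s) (f0 s) h g"
    if g: "g \<in> generators P K" "fst g = y" for g h
    unfolding mat_mult_def
  proof (rule sum.cong[OF refl])
    fix k assume "k \<in> generators P K"
    have "boundary_ok (f0 s) g" using bd g y by simp
    then have "fst k \<noteq> x" if "f0 s k g \<noteq> 0" using boundary_ok_support(1) that g(2) notx by blast
    then show "f0 t h k * f0 t k g = f0 s h k * f0 s k g"
      using f[of g] g yx f by (cases "f0 s k g = 0") auto
  qed
  moreover have "(\<lambda>r'. f1 t r' r) = (\<lambda>r'. f1 s r' r)" if "fst r = y" for r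
    using fr that yx by (simp add: frame_def)
  moreover have "(\<lambda>r'. theta t r' g) = (\<lambda>r'. theta s r' g)" if "fst g = y" for g
    using fr that yx by (simp add: frame_def)
  ultimately show "lifted t y"
    using ok(2) rels yx unfolding lifted_def same by simp
qed

lemma achieves_lift_routine:
  assumes t: "grade_done t"
  shows "achieves (lift_routine P K x) t (processed (insert x D))"
proof (rule achievesI)
  let ?S = "generators P K" and ?F = "forest t x"
  have F: "graph_ok (rels t) (p1 t) x ?F" "acyclic_mgraph ?F"
    using t by (simp_all add: grade_done_def grade_ok_def)
  \<comment> \<open>The columns are independent of each other, so the matrices \<open>M\<close> and
    \<open>T\<close> arise by choosing every column separately.\<close>
  have ex: "\<exists>d. if b then lift_column P K ?F c d else d = z" for b c z
    using lift_column_exists[OF F] by (cases b) simp_all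
  have "\<forall>r. \<exists>d. if r \<in> rels t \<and> fst r = x
      then lift_column P K ?F (\<lambda>g. mat_mult ?S (f0 t) (p1 t) g r) d else d = (\<lambda>r'. f1 t r' r)"
    by (intro allI ex)
  then obtain M where M: "\<forall>r. if r \<in> rels t \<and> fst r = x
      then lift_column P K ?F (\<lambda>g. mat_mult ?S (f0 t) (p1 t) g r) (M r) else M r = (\<lambda>r'. f1 t r' r)"
    by metis
  have "\<forall>g. \<exists>d. if g \<in> ?S \<and> fst g = x
      then lift_column P K ?F (\<lambda>h. mat_mult ?S (f0 t) (f0 t) h g) d else d = (\<lambda>r'. theta t r' g)"
    by (intro allI ex)
  then obtain T where T: "\<forall>g. if g \<in> ?S \<and> fst g = x
      then lift_column P K ?F (\<lambda>h. mat_mult ?S (f0 t) (f0 t) h g) (T g) else T g = (\<lambda>r'. theta t r' g)"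
    by metis
  have "lift_routine P K x t (t\<lparr>f1 := (\<lambda>r' r. M r r'), theta := (\<lambda>r' g. T g r')\<rparr>)"
    unfolding lift_routine_def
  proof (intro exI conjI allI)
    fix r
    show "if r \<in> rels t \<and> fst r = x
      then lift_column P K ?F (\<lambda>g. mat_mult ?S (f0 t) (p1 t) g r) (\<lambda>r'. M r r') else \<forall>r'. M r r' = f1 t r' r"
      using M[rule_format, of r] by (auto split: if_splits)
  next
    fix g
    show "if g \<in> ?S \<and> fst g = x
      then lift_column P K ?F (\<lambda>h. mat_mult ?S (f0 t) (f0 t) h g) (\<lambda>r'. T g r') else \<forall>r'. T g r' = theta t r' g"
      using T[rule_format, of g] by (auto split: if_splits)
  qed simp
  then show "\<exists>t'. lift_routine P K x t t'" ..
next
  let ?S = "generators P K" and ?F = "forest t x"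
  fix t'
  assume "lift_routine P K x t t'"
  then obtain M T where
    M: "\<And>r. if r \<in> rels t \<and> fst r = x
      then lift_column P K ?F (\<lambda>g. mat_mult ?S (f0 t) (p1 t) g r) (\<lambda>r'. M r' r) else \<forall>r'. M r' r = f1 t r' r"
    and T: "\<And>g. if g \<in> ?S \<and> fst g = x
      then lift_column P K ?F (\<lambda>h. mat_mult ?S (f0 t) (f0 t) h g) (\<lambda>r'. T r' g) else \<forall>r'. T r' g = theta t r' g"
    and t': "t' = t\<lparr>f1 := M, theta := T\<rparr>"
    unfolding lift_routine_def by blast
  have same: "act t' = act t" "forest t' = forest t" "rels t' = rels t" "p1 t' = p1 t" "f0 t' = f0 t"
    "f1 t' = M" "theta t' = T" by (simp_all add: t')
  have "M r' r = f1 t r' r" if "fst r \<noteq> x" for r r' using M[of r] that by simp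
  moreover have "T r' g = theta t r' g" if "fst g \<noteq> x" for g r' using T[of g] that by simp
  ultimately have "frame x t t'" by (simp add: frame_def same)
  then have fr: "frame x s t'" using t frame_trans by (auto simp: grade_done_def)
  have "lifted t' x"
    unfolding lifted_def same
  proof (intro conjI ballI impI)
    fix r assume "r \<in> rels t" "fst r = x"
    then show "lift_column P K ?F (\<lambda>g. mat_mult ?S (f0 t) (p1 t) g r) (\<lambda>r'. M r' r)" using M[of r] by simp
  next
    fix g assume "g \<in> ?S" "fst g = x"
    then show "lift_column P K ?F (\<lambda>h. mat_mult ?S (f0 t) (f0 t) h g) (\<lambda>r'. T r' g)" using T[of g] by simp
  qed
  moreover have "grade_ok t' x" using t by (simp add: grade_done_def grade_ok_def same)
  moreover have "rels_ok (insert x D) t'" using t by (simp add: grade_done_def rels_ok_def same)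
  moreover have "boundary_ok (f0 t') g" if "g \<in> ?S" "fst g = x" for g
    using t that by (simp add: grade_done_def same)
  ultimately show "processed (insert x D) t'"
    using processed_frame[OF fr] unfolding processed_def by blast
qed

lemma achieves_grade:
  "achieves (collapse P K x OO generator P K x OO lift_routine P K x) s (processed (insert x D))"
  unfolding generator_def relcompp_assoc
  by (intro achieves_OO[OF achieves_collapse] achieves_OO[OF achieves_add_generators]
      achieves_OO[OF achieves_merge] achieves_OO[OF achieves_choose_forest] achieves_lift_routine) auto

end

section \<open>Running through all grades\<close>

context finite_poset_tower
begin

text \<open>The linear extension is used twice: all grades below the current one precede it, and the
  treated prefix is closed downwards.\<close>

lemma pirep_processed:
  assumes lin: "linear_extension P xs"
  shows "(\<exists>s. pirep P K xs s) \<and> (\<forall>s. pirep P K xs s \<longrightarrow> processed P s)"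
proof -
  have xs: "distinct xs" "set xs = P" "sorted_wrt (\<lambda>x y. \<not> y < x) xs"
    using lin by (auto simp: linear_extension_def)
  have "achieves (foreach_list (\<lambda>x. collapse P K x OO generator P K x OO lift_routine P K x) xs) initial_state
    (processed (set xs))"
  proof (rule achieves_foreach_list)
    show "processed (set []) initial_state"
      by (simp add: processed_def rels_ok_def initial_state_def)
  next
    fix ps x qs t
    assume split: "xs = ps @ x # qs" and pr: "processed (set ps) t"
    have notless: "\<not> z < y" if "y \<in> set ps" "z \<in> set (x # qs)" for y z
      using xs(3) that unfolding split by (auto simp: sorted_wrt_append)
    have notless': "\<not> z < x" if "z \<in> set qs" for z
      using xs(3) that unfolding split by (auto simp: sorted_wrt_append)
    have P: "P = set ps \<union> {x} \<union> set qs" using xs(2) split by auto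
    interpret processing_step P K "set ps" x t
    proof
      show "x \<in> P" "set ps \<subseteq> P" using P by auto
      show "x \<notin> set ps" using xs(1) split by simp
      show "y \<in> set ps" if "y \<in> P" "y < x" for y
        using that P notless' by auto
      show "z \<in> set ps" if "y \<in> set ps" "z \<in> P" "z \<le> y" for y z
        using that P notless[of y z] by (cases "z = y") auto
    qed (fact pr)
    show "achieves (collapse P K x OO generator P K x OO lift_routine P K x) t (processed (set (ps @ [x])))"
      using achieves_grade by simp
  qed
  then show ?thesis using xs(2) by (simp add: achieves_def pirep_def)
qed

end

theorem theorem53:
  fixes P :: "'p::order set" and K :: "('p, 'v) tower" and xs :: "'p list"
  assumes "finite P"
    and "poset_tower P K"
    and "linear_extension P xs"
  shows "(\<exists>s. pirep P K xs s) \<and>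
    (\<forall>s. pirep P K xs s \<longrightarrow> (\<forall>l::int.
      let G = generators_of_dim P K;
          R = relations_of_dim s;
          p1_at = (\<lambda>k. columns (R k) (p1 s));
          f0_at = (\<lambda>k. columns (G k) (f0 s));
          f1_at = (\<lambda>k. columns (R k) (f1 s));
          theta_at = (\<lambda>k. columns (G k) (theta s))
      in proj_hom (R l) (G l) (p1_at l) \<and>
         proj_hom (G l) (G (l - 1)) (f0_at l) \<and>
         proj_hom (R l) (R (l - 1)) (f1_at l) \<and>
         proj_hom (G (l + 1)) (R (l - 1)) (theta_at (l + 1)) \<and>
         mat_mult (R (l - 1)) (p1_at (l - 1)) (f1_at l) = mat_mult (G l) (f0_at l) (p1_at l) \<and>
         mat_mult (R (l - 1)) (p1_at (l - 1)) (theta_at (l + 1)) =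
           mat_mult (G l) (f0_at l) (f0_at (l + 1))))"
proof -
  interpret finite_poset_tower P K using assms(1,2) by unfold_locales
  show ?thesis unfolding Let_def using pirep_processed[OF assms(3)] lift_correct by blast
qed

end
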